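(* Let $M\in\mathrm{M}_n(\mathbb{K})$ with minimal polynomial $\mu_M=f_1^{m_1}\cdots f_s^{m_s}$ and characteristic polynomial $\chi_M=f_1^{n_1}\cdots f_s^{n_s}$, where $f_1,\dots,f_s\in\mathbb{K}[x]$ are pairwise distinct monic irreducible polynomials and $m_i,n_i\ge1$. For $i\in\{1,\dots,s\}$ let $d_i=\dim_{\mathbb{K}}\ker(f_i^{m_i}(M))$ (which equals $n_i\deg f_i$) and let $P_i\in\mathrm{M}_{d_i\times n}(\mathbb{K})$ be a matrix whose rows form a $\mathbb{K}$-basis of $\ker(f_i^{m_i}(M))\subseteq\mathbb{K}^n$. Let $\mathcal{C}$ be an $M$-code with parameters $[n,k]$, $k\ge1$; let $k_i=\dim_{\mathbb{L}}(\mathcal{C}\cap\ker(f_i^{m_i}(M)))$ (kernel taken in $\mathbb{L}^n$), $\mathcal{C}_i=\{c\in\mathbb{L}^{d_i} : cP_i\in\mathcal{C}\cap\ker(f_i^{m_i}(M))\}$, and $\Lambda=\{i : \mathcal{C}\cap\ker(f_i^{m_i}(M))\neq\{0\}\}$. Then for all $r\in\{1,\dots,k\}$, $$M_r(\mathcal{C})=\min_{\substack{\sum_{i\in\Lambda}r_i=r\\ r_i\in\{0,\dots,k_i\}}}\sum_{i\in\Lambda}M_{r_i}(\mathcal{C}_i)=\min_{\substack{\sum_{i\in\Lambda}r_i=r\\ r_i\in\{0,\dots,k_i\}}}\sum_{i\in\Lambda}M_{r_i}(\mathcal{C}\cap\ker(f_i^{m_i}(M))),$$ for all $i\in\Lambda$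 and $r_i\in\{1,\dots,k_i\}$ we have $M_{r_i}(\mathcal{C}_i)=M_{r_i}(\mathcal{C}\cap\ker(f_i^{m_i}(M)))\le n_i\deg(f_i)-k_i+r_i$, and for all $r\in\{1,\dots,k\}$, $$M_r(\mathcal{C})\le\min_{\substack{\sum_{i\in\Lambda}r_i=r\\ r_i\in\{0,\dots,k_i\}}}\Big(\sum_{i\in\Lambda,\ r_i\ne0}(n_i\deg(f_i)-k_i)\Big)+r.$$ In particular $M_1(\mathcal{C})=\min_{i\in\Lambda}M_1(\mathcal{C}_i)\le\min_{i\in\Lambda}(n_i\deg(f_i)-k_i)+1$ and $M_k(\mathcal{C})=\sum_{i\in\Lambda}M_{k_i}(\mathcal{C}_i)\le\sum_{i\in\Lambda}n_i\deg(f_i)$.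
   Context: Let $\mathbb{L}/\mathbb{K}$ be a field extension of finite degree $m$, and $n\ge 1$ an integer with $m\ge n$ (standing assumption). Vectors are row vectors; for a matrix $A$ with entries in $\mathbb{K}$, $\ker(A)$ denotes $\{c : cA^t=0\}$ in $\mathbb{K}^n$ or in $\mathbb{L}^n$ as indicated. Fix a $\mathbb{K}$-basis $\mathcal{B}$ of $\mathbb{L}$; for $c=(c_1,\dots,c_n)\in\mathbb{L}^n$ let $M_{\mathcal{B}}(c)\in\mathrm{M}_{m\times n}(\mathbb{K})$ be the matrix whose $j$-th column is the coordinate vector of $c_j$ in $\mathcal{B}$. The rank support $\mathrm{Rsupp}(c)\subseteq\mathbb{K}^n$ is the $\mathbb{K}$-row space of $M_{\mathcal{B}}(c)$, and $\mathrm{wt}_R(c)=\dim_{\mathbb{K}}\mathrm{Rsupp}(c)$. For an $\mathbb{L}$-subspace $\mathcal{D}\subseteq\mathbb{L}^n$, $\mathrm{Rsupp}(\mathcal{D})$ is the $\mathbb{K}$-span of all $\mathrm{Rsupp}(d)$, $d\in\mathcal{D}$, and $\mathrm{wt}_R(\mathcal{D})=\dim_{\mathbb{K}}\mathrm{Rsupp}(\mathcal{D})$. A linear $[n,k]$ code is a $k$-dimensional $\mathbb{L}$-subspace $\mathcal{C}\subseteq\mathbb{L}^n$; for $1\le r\le k$, $M_r(\mathcal{C})=\min\{\mathrm{wt}_R(\mathcal{D}) : \mathcal{D}\subseteq\mathcal{C},\ \dim_{\mathbb{L}}\mathcal{D}=r\}$, and $M_0(\mathcal{C})=0$ by convention.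 For $M\in\mathrm{M}_n(\mathbb{K})$, a linear code $\mathcal{C}\subseteq\mathbb{L}^n$ is an $M$-code if $cM^t\in\mathcal{C}$ for all $c\in\mathcal{C}$. *)

theory Defs
  imports "Jordan_Normal_Form.Matrix_Kernel" "Jordan_Normal_Form.Char_Poly"
begin

text \<open>Vectors of length n are JNF vectors in carrier_vec n; K^n and L^n are the
  vector spaces module_vec TYPE('k) n and module_vec TYPE('l) n over the field
  of scalars given by the type (class_ring).\<close>

definition vsubspace :: "nat \<Rightarrow> 'a :: field vec set \<Rightarrow> bool" where
  "vsubspace n W \<longleftrightarrow> VectorSpace.subspace class_ring W (module_vec TYPE('a) n)"

definition vspan :: "nat \<Rightarrow> 'a :: field vec set \<Rightarrow> 'a vec set" where
  "vspan n S = LinearCombinations.module.span class_ring (module_vec TYPE('a) n) S"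

definition vlin_indpt :: "nat \<Rightarrow> 'a :: field vec set \<Rightarrow> bool" where
  "vlin_indpt n S \<longleftrightarrow> module.lin_indpt class_ring (module_vec TYPE('a) n) S"

definition vdim :: "nat \<Rightarrow> 'a :: field vec set \<Rightarrow> nat" where
  "vdim n W = vectorspace.dim class_ring ((module_vec TYPE('a) n)\<lparr>carrier := W\<rparr>)"

definition poly_mat :: "'a :: comm_ring_1 poly \<Rightarrow> 'a mat \<Rightarrow> 'a mat" where
  "poly_mat p A = foldr (\<lambda>i B. coeff p i \<cdot>\<^sub>m (A ^\<^sub>m i) + B) [0..<Suc (degree p)]
     (0\<^sub>m (dim_row A) (dim_row A))"

definition is_minimal_poly :: "'a :: field mat \<Rightarrow> 'a poly \<Rightarrow> bool" where
  "is_minimal_poly A p \<longleftrightarrow> monic p \<and> poly_mat p A = 0\<^sub>m (dim_row A) (dim_row A) \<and>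
     (\<forall>q. q \<noteq> 0 \<and> poly_mat q A = 0\<^sub>m (dim_row A) (dim_row A) \<longrightarrow> degree p \<le> degree q)"

text \<open>The extension L/K is given by a field embedding \<iota> : K \<rightarrow> L. An ordered K-basis
  of L is a list B such that every element of L has unique coordinates.\<close>
definition ordered_basis :: "('k :: field \<Rightarrow> 'l :: field) \<Rightarrow> 'l list \<Rightarrow> bool" where
  "ordered_basis \<iota> B \<longleftrightarrow> (\<forall>x. \<exists>!a. a \<in> carrier_vec (length B) \<and>
      x = (\<Sum>j<length B. \<iota> (a $ j) * B ! j))"

definition coord :: "('k :: field \<Rightarrow> 'l :: field) \<Rightarrow> 'l list \<Rightarrow> 'l \<Rightarrow> 'k vec" where
  "coord \<iota> B x = (THE a. a \<in> carrier_vec (length B) \<and> x = (\<Sum>j<length B. \<iota> (a $ j) * B ! j))"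

definition MB :: "('k :: field \<Rightarrow> 'l :: field) \<Rightarrow> 'l list \<Rightarrow> 'l vec \<Rightarrow> 'k mat" where
  "MB \<iota> B c = mat (length B) (dim_vec c) (\<lambda>(i, j). coord \<iota> B (c $ j) $ i)"

definition Rsupp :: "('k :: field \<Rightarrow> 'l :: field) \<Rightarrow> 'l list \<Rightarrow> nat \<Rightarrow> 'l vec \<Rightarrow> 'k vec set" where
  "Rsupp \<iota> B n c = vspan n (set (rows (MB \<iota> B c)))"

definition Rsupp_set :: "('k :: field \<Rightarrow> 'l :: field) \<Rightarrow> 'l list \<Rightarrow> nat \<Rightarrow> 'l vec set \<Rightarrow> 'k vec set" where
  "Rsupp_set \<iota> B n D = vspan n (\<Union>d\<in>D. Rsupp \<iota> B n d)"

definition wtR :: "('k :: field \<Rightarrow> 'l :: field) \<Rightarrow> 'l list \<Rightarrow> nat \<Rightarrow> 'l vec set \<Rightarrow> nat" where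
  "wtR \<iota> B n D = vdim n (Rsupp_set \<iota> B n D)"

definition Mr :: "('k :: field \<Rightarrow> 'l :: field) \<Rightarrow> 'l list \<Rightarrow> nat \<Rightarrow> 'l vec set \<Rightarrow> nat \<Rightarrow> nat" where
  "Mr \<iota> B n C r = (if r = 0 then 0 else
     Min {wtR \<iota> B n D | D. vsubspace n D \<and> D \<subseteq> C \<and> vdim n D = r})"

text \<open>C is an M-code: a linear code in L^n stable under c \<mapsto> c M^t.\<close>
definition is_M_code :: "('k :: field \<Rightarrow> 'l :: field) \<Rightarrow> nat \<Rightarrow> 'k mat \<Rightarrow> 'l vec set \<Rightarrow> bool" where
  "is_M_code \<iota> n M C \<longleftrightarrow> vsubspace n C \<and> (\<forall>c\<in>C. map_mat \<iota> M *\<^sub>v c \<in> C)"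

end

theory Submission
  imports Defs "HOL-Computational_Algebra.Polynomial_Factorial"
begin

text \<open>The primary idempotents \<open>E 1, \<dots>, E s\<close> of \<open>M\<close> are polynomials in \<open>M\<close>, so they act on
  \<open>K^n\<close> and on \<open>C\<close>. Put \<open>F j = {v. E l v = 0 for all l > j}\<close>. By rank-nullity, every subspace
  \<open>V\<close>, invariant or not, satisfies \<open>dim V = \<Sum>j. dim (E j (V \<inter> F j))\<close>. Apply this to a subcode
  \<open>D\<close> and to its rank support \<open>V\<close>: since \<open>E j\<close> has entries in \<open>K\<close>, the support of the piece
  \<open>E j (D \<inter> F j)\<close> of \<open>C \<inter> ker (f j ^ m j) (M)\<close> lies in \<open>E j (V \<inter> F j)\<close>. Hence the weights of the
  pieces add up to at most the weight of \<open>D\<close>; the converse inequality is subadditivity of the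
  weight on direct sums. The upper bounds are the Singleton bound for \<open>C i\<close>, whose length
  \<open>d i\<close> is at most \<open>n i deg (f i)\<close>.\<close>

subsection \<open>Subspaces of coordinate spaces and their dimension\<close>

text \<open>The obstacle is that a subcode \<open>D\<close> of \<open>C\<close> need not be stable
  under \<open>M\<close>. It is then not the sum of its intersections with the primary components,
  and the dimensions of the full projections of \<open>D\<close> can add up to more than the
  dimension of \<open>D\<close>. Cutting with the filtration before projecting removes this
  overcount. The price is that the pieces depend on the numbering of the factors and need not lie in
  \<open>D\<close>; they do lie in \<open>C\<close>, because \<open>C\<close> is stable under the
  idempotents.

  The field extension enters through coordinates with respect to \<open>B\<close>. A coordinate
  functional is K-linear, so taking coordinates commutes with matrices over K. The same matrices
  therefore filter \<open>D\<close> over L and its support over K, and the coordinate vectors of an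
  element of one filtration step lie in the corresponding step of the support.\<close>

lemma zero_mult_mat_vec: "v \<in> carrier_vec n \<Longrightarrow> 0\<^sub>m p n *\<^sub>v v = (0\<^sub>v p :: 'a :: semiring_0 vec)"
  by (auto simp: scalar_prod_def intro!: eq_vecI)

lemma vsubspace_iff:
  "vsubspace n (W :: 'a :: field vec set) \<longleftrightarrow> W \<subseteq> carrier_vec n \<and> 0\<^sub>v n \<in> W \<and>
     (\<forall>v\<in>W. \<forall>w\<in>W. v + w \<in> W) \<and> (\<forall>c. \<forall>v\<in>W. c \<cdot>\<^sub>v v \<in> W)"
  unfolding vsubspace_def VectorSpace.subspace_def submodule_def
  using vec_vs[where 'a = 'a, of n] vec_module[where 'a = 'a, of n]
  by (auto simp: module_vec_simps class_ring_simps)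

lemma vsubspaceI:
  assumes "W \<subseteq> carrier_vec n" "0\<^sub>v n \<in> W" "\<And>v w. v \<in> W \<Longrightarrow> w \<in> W \<Longrightarrow> v + w \<in> W"
    "\<And>c v. v \<in> W \<Longrightarrow> c \<cdot>\<^sub>v v \<in> W"
  shows "vsubspace n W"
  using assms unfolding vsubspace_iff by blast

lemma vsubspaceD:
  assumes "vsubspace n W"
  shows "W \<subseteq> carrier_vec n" "0\<^sub>v n \<in> W" "\<And>v w. v \<in> W \<Longrightarrow> w \<in> W \<Longrightarrow> v + w \<in> W"
    "\<And>c v. v \<in> W \<Longrightarrow> c \<cdot>\<^sub>v v \<in> W" "\<And>v. v \<in> W \<Longrightarrow> v \<in> carrier_vec n"
  using assms unfolding vsubspace_iff by blast+

lemma vsubspace_carrier: "vsubspace n (carrier_vec n)"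
  by (rule vsubspaceI) auto

lemma vsubspace_zero: "vsubspace n {0\<^sub>v n}"
  by (rule vsubspaceI) auto

lemma vsubspace_Int: "vsubspace n V \<Longrightarrow> vsubspace n W \<Longrightarrow> vsubspace n (V \<inter> W)"
  unfolding vsubspace_iff by blast

lemma vsubspace_image:
  assumes "vsubspace n W" "A \<in> carrier_mat p n"
  shows "vsubspace p ((*\<^sub>v) A ` W)"
proof (rule vsubspaceI)
  note W = vsubspaceD[OF assms(1)] and A = assms(2)
  show "(*\<^sub>v) A ` W \<subseteq> carrier_vec p" using A W by auto
  show "0\<^sub>v p \<in> (*\<^sub>v) A ` W" using W(2) A by (auto intro!: rev_image_eqI[of "0\<^sub>v n"])
  show "v + w \<in> (*\<^sub>v) A ` W" if "v \<in> (*\<^sub>v) A ` W" "w \<in> (*\<^sub>v) A ` W" for v w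
  proof -
    from that obtain x y where xy: "x \<in> W" "y \<in> W" "v = A *\<^sub>v x" "w = A *\<^sub>v y" by auto
    then have "v + w = A *\<^sub>v (x + y)" using W(5) A by (simp add: mult_add_distrib_mat_vec)
    then show ?thesis using W(3) xy by auto
  qed
  show "c \<cdot>\<^sub>v v \<in> (*\<^sub>v) A ` W" if "v \<in> (*\<^sub>v) A ` W" for c v
  proof -
    from that obtain x where x: "x \<in> W" "v = A *\<^sub>v x" by auto
    then have "c \<cdot>\<^sub>v v = A *\<^sub>v (c \<cdot>\<^sub>v x)" using W(5) A by (simp add: mult_mat_vec)
    then show ?thesis using W(4) x by auto
  qed
qed

lemma vsubspace_vimage:
  assumes "vsubspace p W" "A \<in> carrier_mat p n"
  shows "vsubspace n {v \<in> carrier_vec n. A *\<^sub>v v \<in> W}"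
proof -
  have "A *\<^sub>v 0\<^sub>v n = 0\<^sub>v p" using assms(2) by auto
  then show ?thesis using vsubspaceD[OF assms(1)] assms(2)
    by (intro vsubspaceI) (auto simp: mult_add_distrib_mat_vec mult_mat_vec)
qed

lemma vsubspace_common_vimage:
  assumes V: "vsubspace n V" and A: "\<And>l. l \<in> L \<Longrightarrow> A l \<in> carrier_mat n n"
    and W: "\<And>l. l \<in> L \<Longrightarrow> vsubspace n (W l)"
  shows "vsubspace n {v \<in> V. \<forall>l\<in>L. A l *\<^sub>v v \<in> W l}" (is "vsubspace n ?S")
proof (rule vsubspaceI)
  note V' = vsubspaceD[OF V]
  have "A l *\<^sub>v 0\<^sub>v n = 0\<^sub>v n" if "l \<in> L" for l using A[OF that] by auto
  then show "0\<^sub>v n \<in> ?S" using V'(2) vsubspaceD(2)[OF W] by auto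
  show "v + w \<in> ?S" if "v \<in> ?S" "w \<in> ?S" for v w
    using that V' vsubspaceD(3)[OF W] A by (auto simp: mult_add_distrib_mat_vec[of _ n n])
  show "c \<cdot>\<^sub>v v \<in> ?S" if "v \<in> ?S" for c v
    using that V' vsubspaceD(4)[OF W] A by (auto simp: mult_mat_vec[of _ n n])
qed (use vsubspaceD[OF V] in auto)

lemma vsubspace_common_kernel:
  assumes "vsubspace n V" "\<And>l. l \<in> L \<Longrightarrow> A l \<in> carrier_mat n n"
  shows "vsubspace n {v \<in> V. \<forall>l\<in>L. A l *\<^sub>v v = 0\<^sub>v n}"
  using vsubspace_common_vimage[OF assms vsubspace_zero] by simp

lemma vsubspace_mat_kernel:
  assumes "A \<in> carrier_mat p n"
  shows "vsubspace n (mat_kernel A)"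
  using vsubspace_vimage[OF vsubspace_zero assms] assms by (simp add: mat_kernel_def)

lemma vsubspace_vspan:
  assumes "S \<subseteq> carrier_vec n"
  shows "vsubspace n (vspan n S)"
proof -
  interpret vec_space "TYPE('a)" n .
  show ?thesis unfolding vsubspace_def vspan_def by (rule span_is_subspace) (use assms in auto)
qed

lemma vspan_superset:
  assumes "S \<subseteq> carrier_vec n"
  shows "S \<subseteq> vspan n S"
proof -
  interpret vec_space "TYPE('a)" n .
  show ?thesis unfolding vspan_def by (rule in_own_span) (use assms in auto)
qed

lemma vspan_minimal:
  assumes "vsubspace n W" "S \<subseteq> W"
  shows "vspan n S \<subseteq> W"
proof -
  interpret vec_space "TYPE('a)" n .
  show ?thesis unfolding vspan_def
    by (rule span_is_subset) (use assms in \<open>auto simp: vsubspace_def VectorSpace.subspace_def\<close>)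
qed

lemma vspan_rows:
  assumes "A \<in> carrier_mat p n"
  shows "vspan n (set (rows A)) = (*\<^sub>v) A\<^sup>T ` carrier_vec p"
proof -
  interpret vec_space "TYPE('a)" n .
  show ?thesis using row_space_eq[OF assms] assms unfolding vspan_def row_space_def by auto
qed

text \<open>Independent subsets of \<open>W\<close> are independent in the whole space, so they have
  at most \<open>n\<close> elements and a maximal one exists; it is a basis of \<open>W\<close>.
  Finite dimension of \<open>W\<close> is exported because rank-nullity on \<open>W\<close> asks for
  it.\<close>

lemma ex_vbasis:
  assumes W: "vsubspace n W"
  obtains b where "finite b" "b \<subseteq> W" "vlin_indpt n b" "vspan n b = W" "card b = vdim n W"
    "vectorspace.fin_dim class_ring ((module_vec TYPE('a :: field) n)\<lparr>carrier := W\<rparr>)"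
proof -
  interpret vec_space "TYPE('a)" n .
  have sub: "VectorSpace.subspace class_ring W V" using W by (simp add: vsubspace_def)
  then have subm: "submodule class_ring W V" by (simp add: VectorSpace.subspace_def)
  interpret S: vectorspace class_ring "vs W" by (rule subspace_is_vs[OF sub])
  have WV: "W \<subseteq> carrier_vec n" using vsubspaceD[OF W] by auto
  let ?P = "\<lambda>A. A \<subseteq> carrier (vs W) \<and> S.lin_indpt A"
  have "finite A \<and> card A \<le> n" if "?P A" for A
  proof -
    have "A \<subseteq> W" "lin_indpt A" using that span_li_not_depend(2)[OF _ subm, of A] by auto
    then show ?thesis using li_le_dim[of A] WV dim_is_n by auto
  qed
  moreover have "?P {}" by (auto simp: S.lin_dep_def)
  ultimately obtain b where b: "finite b" "maximal b ?P" using maximal_exists[of ?P n "{}"] by blast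
  have bas: "S.basis b" by (rule S.max_li_is_basis[OF b(2)])
  then have bW: "b \<subseteq> W" "S.lin_indpt b" "S.span b = W" unfolding S.basis_def by auto
  have fd: S.fin_dim unfolding S.fin_dim_def using bas b(1) by (auto simp: S.basis_def)
  show thesis
  proof (rule that[OF b(1) bW(1)])
    show "vlin_indpt n b" "vspan n b = W" using bW span_li_not_depend[OF bW(1) subm]
      by (auto simp: vlin_indpt_def vspan_def)
    show "card b = vdim n W" using S.dim_basis[OF b(1) bas] by (simp add: vdim_def)
    show "vectorspace.fin_dim class_ring (vs W)" by (rule fd)
  qed
qed

lemma vdim_carrier: "vdim n (carrier_vec n :: 'a :: field vec set) = n"
proof -
  interpret vec_space "TYPE('a)" n .
  have "V\<lparr>carrier := carrier_vec n\<rparr> = V" by (simp add: module_vec_def)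
  then show ?thesis using dim_is_n unfolding vdim_def by (simp only:)
qed

lemma vlin_indpt_card_le:
  assumes W: "vsubspace n (W :: 'a :: field vec set)" and b: "b \<subseteq> W" "vlin_indpt n b"
  shows "card b \<le> vdim n W"
proof -
  interpret vec_space "TYPE('a)" n .
  have sub: "VectorSpace.subspace class_ring W V" using W by (simp add: vsubspace_def)
  then have subm: "submodule class_ring W V" by (simp add: VectorSpace.subspace_def)
  interpret S: vectorspace class_ring "vs W" by (rule subspace_is_vs[OF sub])
  have "S.fin_dim" using ex_vbasis[OF W] by blast
  moreover have "S.lin_indpt b" using b span_li_not_depend(2)[OF b(1) subm]
    by (auto simp: vlin_indpt_def)
  ultimately show ?thesis using S.li_le_dim(2)[of b] b by (auto simp: vdim_def)
qed

lemma vdim_mono: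
  assumes "vsubspace n V" "vsubspace n W" "V \<subseteq> W"
  shows "vdim n V \<le> vdim n W"
  using ex_vbasis[OF assms(1)] vlin_indpt_card_le[OF assms(2)] assms(3) by (metis subset_trans)

lemma vdim_le: "vsubspace n V \<Longrightarrow> vdim n V \<le> n"
  using vdim_mono[OF _ vsubspace_carrier] vsubspaceD(1) by (metis vdim_carrier)

lemma vspan_empty: "vspan n {} = {0\<^sub>v n}"
  using vspan_minimal[OF vsubspace_zero, of "{}"] vsubspaceD(2)[OF vsubspace_vspan, of "{}"] by auto

lemma vdim_eq_0_iff:
  assumes "vsubspace n V"
  shows "vdim n V = 0 \<longleftrightarrow> V = {0\<^sub>v n}"
proof
  assume "vdim n V = 0"
  then show "V = {0\<^sub>v n}" using ex_vbasis[OF assms] vspan_empty by (metis card_0_eq)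
next
  assume V: "V = {0\<^sub>v n}"
  obtain b where b: "finite b" "b \<subseteq> V" "vlin_indpt n b" "card b = vdim n V"
    using ex_vbasis[OF assms] by metis
  interpret vec_space "TYPE('a)" n .
  have "0\<^sub>v n \<notin> b" using vs_zero_lin_dep[of b] b V by (auto simp: vlin_indpt_def)
  then have "b = {}" using b(2) V by auto
  then show "vdim n V = 0" using b(4) by simp
qed

lemma vdim_rank_nullity:
  fixes W :: "'a :: field vec set"
  assumes W: "vsubspace n W" and A: "A \<in> carrier_mat p n"
  shows "vdim n W = vdim p ((*\<^sub>v) A ` W) + vdim n (W \<inter> mat_kernel A)"
proof -
  interpret N: vec_space "TYPE('a)" n .
  interpret P: vec_space "TYPE('a)" p .
  have sub: "VectorSpace.subspace class_ring W N.V" using W by (simp add: vsubspace_def)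
  interpret S: vectorspace class_ring "N.vs W" by (rule N.subspace_is_vs[OF sub])
  note W' = vsubspaceD[OF W]
  have "(*\<^sub>v) A \<in> LinearCombinations.module_hom class_ring (N.vs W) P.V"
    unfolding LinearCombinations.module_hom_def using A W'(5)
    by (auto simp: module_vec_simps mult_add_distrib_mat_vec mult_mat_vec)
  then have "mod_hom class_ring (N.vs W) P.V ((*\<^sub>v) A)"
    by (intro mod_hom.intro mod_hom_axioms.intro S.module_axioms P.module_axioms)
  then interpret L: linear_map class_ring "N.vs W" P.V "(*\<^sub>v) A"
    by (intro linear_map.intro S.vectorspace_axioms P.vectorspace_axioms)
  have fd: "S.fin_dim" using ex_vbasis[OF W] by blast
  have im: "L.imT = (*\<^sub>v) A ` W" unfolding L.im_def by simp
  have ker: "L.kerT = W \<inter> mat_kernel A" unfolding L.ker_def using W' A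
    by (auto simp: mat_kernel_def module_vec_simps)
  show ?thesis using L.rank_nullity[OF fd] unfolding im ker by (simp add: vdim_def)
qed

lemma vdim_image_le:
  "vsubspace n W \<Longrightarrow> A \<in> carrier_mat p n \<Longrightarrow> vdim p ((*\<^sub>v) A ` W) \<le> vdim n W"
  using vdim_rank_nullity by (metis le_add1)

lemma vdim_image_inj:
  assumes W: "vsubspace n W" and A: "A \<in> carrier_mat p n"
    and inj: "\<And>v. v \<in> W \<Longrightarrow> A *\<^sub>v v = 0\<^sub>v p \<Longrightarrow> v = 0\<^sub>v n"
  shows "vdim p ((*\<^sub>v) A ` W) = vdim n W"
proof -
  have "W \<inter> mat_kernel A = {0\<^sub>v n}"
    using inj A vsubspaceD[OF W] by (auto simp: mat_kernel_def)
  moreover have "vdim n {0\<^sub>v n :: 'a vec} = 0" using vdim_eq_0_iff[OF vsubspace_zero] by blast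
  ultimately show ?thesis using vdim_rank_nullity[OF W A] by simp
qed

text \<open>The matrix \<open>?A\<close> reads off the coordinates from \<open>j\<close> on, so its
  rank is at most \<open>n - j\<close> and its kernel on \<open>W\<close> is the subspace on the
  right. This is the shortening step of the Singleton bound.\<close>

lemma vdim_drop_coords:
  assumes W: "vsubspace n (W :: 'a :: field vec set)"
  shows "vdim n W \<le> vdim n {v \<in> W. \<forall>i\<in>{j..<n}. v $ i = 0} + (n - j)"
proof -
  let ?A = "mat (n - j) n (\<lambda>(a, b). if b = a + j then 1 else 0 :: 'a)"
  have A: "?A \<in> carrier_mat (n - j) n" by simp
  have idx: "(?A *\<^sub>v v) $ a = v $ (a + j)" if v: "v \<in> carrier_vec n" and a: "a < n - j" for v a
  proof -
    have "(?A *\<^sub>v v) $ a = (\<Sum>b = 0..<n. (if b = a + j then 1 else 0) * v $ b)"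
      using a v by (auto simp: scalar_prod_def intro!: sum.cong)
    also have "\<dots> = (\<Sum>b = 0..<n. if b = a + j then v $ b else 0)" by (rule sum.cong) auto
    also have "\<dots> = v $ (a + j)" using a by (subst sum.delta) auto
    finally show ?thesis .
  qed
  have "v \<in> mat_kernel ?A \<longleftrightarrow> (\<forall>i\<in>{j..<n}. v $ i = 0)" if v: "v \<in> carrier_vec n" for v
  proof -
    have "v \<in> mat_kernel ?A \<longleftrightarrow> (\<forall>a < n - j. v $ (a + j) = 0)"
      using v idx[OF v] by (auto simp: mat_kernel_def vec_eq_iff)
    also have "\<dots> \<longleftrightarrow> (\<forall>i\<in>{j..<n}. v $ i = 0)"
    proof (intro iffI ballI allI impI)
      fix i assume h: "\<forall>a < n - j. v $ (a + j) = 0" and i: "i \<in> {j..<n}"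
      show "v $ i = 0" using h[rule_format, of "i - j"] i by auto
    qed auto
    finally show ?thesis .
  qed
  then have "W \<inter> mat_kernel ?A = {v \<in> W. \<forall>i\<in>{j..<n}. v $ i = 0}"
    using vsubspaceD[OF W] by auto
  moreover have "vdim (n - j) ((*\<^sub>v) ?A ` W) \<le> n - j" by (rule vdim_le[OF vsubspace_image[OF W A]])
  ultimately show ?thesis using vdim_rank_nullity[OF W A] by simp
qed

text \<open>Such vectors are vectors of length \<open>j\<close> padded with zeros. Since
  \<open>j\<close> may exceed \<open>n\<close>, the preimage under the padding matrix is cut off at
  \<open>n\<close>.\<close>

lemma vdim_coords_zero_le:
  "vdim n {v \<in> carrier_vec n. \<forall>i\<in>{j..<n}. v $ i = (0 :: 'a :: field)} \<le> j"
  (is "vdim n ?V \<le> j")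
proof -
  let ?A = "mat n j (\<lambda>(a, b). if a = b then 1 else 0 :: 'a)"
  have A: "?A \<in> carrier_mat n j" by simp
  have V: "vsubspace n ?V" by (rule vsubspaceI) auto
  have "?V \<subseteq> (*\<^sub>v) ?A ` carrier_vec j"
  proof
    fix v assume v: "v \<in> ?V"
    have "v = ?A *\<^sub>v vec j (\<lambda>b. if b < n then v $ b else 0)"
    proof (rule eq_vecI)
      fix a assume "a < dim_vec (?A *\<^sub>v vec j (\<lambda>b. if b < n then v $ b else 0))"
      then have a: "a < n" by simp
      have "(?A *\<^sub>v vec j (\<lambda>b. if b < n then v $ b else 0)) $ a =
          (\<Sum>b = 0..<j. (if a = b then 1 else 0) * (if b < n then v $ b else 0))"
        using a by (simp add: scalar_prod_def)
      also have "\<dots> = (\<Sum>b = 0..<j. if a = b then (if b < n then v $ b else 0) else 0)"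
        by (rule sum.cong) auto
      also have "\<dots> = v $ a" using v a by simp
      finally show "v $ a = (?A *\<^sub>v vec j (\<lambda>b. if b < n then v $ b else 0)) $ a" by simp
    qed (use v in simp)
    then show "v \<in> (*\<^sub>v) ?A ` carrier_vec j" by (rule image_eqI) simp
  qed
  then have "vdim n ?V \<le> vdim n ((*\<^sub>v) ?A ` carrier_vec j)"
    by (rule vdim_mono[OF V vsubspace_image[OF vsubspace_carrier A]])
  also have "\<dots> \<le> j" using vdim_image_le[OF vsubspace_carrier A] by (simp add: vdim_carrier)
  finally show ?thesis .
qed

text \<open>The span of \<open>r\<close> elements of a basis of \<open>W\<close>. It makes the set
  minimised in \<open>Mr\<close> nonempty, and cuts a subcode of exact dimension out of a larger
  one.\<close>

lemma ex_subspace_of_vdim: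
  assumes W: "vsubspace n W" and r: "r \<le> vdim n W"
  obtains D where "vsubspace n D" "D \<subseteq> W" "vdim n D = r"
proof -
  obtain b where b: "finite b" "b \<subseteq> W" "vlin_indpt n b" "card b = vdim n W"
    using ex_vbasis[OF W] by metis
  obtain b' where b': "b' \<subseteq> b" "card b' = r" "finite b'" using obtain_subset_with_card_n[of r b] r b
    by metis
  interpret vec_space "TYPE('a)" n .
  have bc: "b' \<subseteq> carrier_vec n" using b' b vsubspaceD[OF W] by auto
  have li: "vlin_indpt n b'" using subset_li_is_li[of b b'] b b' by (auto simp: vlin_indpt_def)
  have sp: "vsubspace n (vspan n b')" by (rule vsubspace_vspan[OF bc])
  have sub: "VectorSpace.subspace class_ring (vspan n b') V" using sp by (simp add: vsubspace_def)
  then have subm: "submodule class_ring (vspan n b') V" by (simp add: VectorSpace.subspace_def)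
  interpret S: vectorspace class_ring "vs (vspan n b')" by (rule subspace_is_vs[OF sub])
  have "S.basis b'" unfolding S.basis_def
    using span_li_not_depend[OF vspan_superset[OF bc] subm] li vspan_superset[OF bc]
    by (auto simp: vlin_indpt_def vspan_def)
  then have "vdim n (vspan n b') = r" using S.dim_basis[OF b'(3)] b' by (simp add: vdim_def)
  then show thesis using that[OF sp] vspan_minimal[OF W, of b'] b b' by auto
qed

subsection \<open>Polynomials in a matrix\<close>

lemma foldr_poly_mat_eq:
  assumes "A \<in> carrier_mat n n"
  shows "foldr (\<lambda>i B. c i \<cdot>\<^sub>m (A ^\<^sub>m i) + B) xs (0\<^sub>m n n) =
    mat n n (\<lambda>(i, j). \<Sum>l\<leftarrow>xs. c l * (A ^\<^sub>m l) $$ (i, j))"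
proof (induction xs)
  case (Cons x xs)
  have "A ^\<^sub>m x \<in> carrier_mat n n" by (rule pow_carrier_mat[OF assms])
  then have "dim_row (A ^\<^sub>m x) = n" "dim_col (A ^\<^sub>m x) = n" by auto
  then show ?case by (simp only: foldr.simps o_apply Cons.IH) (auto intro!: eq_matI)
qed (auto intro!: eq_matI)

text \<open>The bound \<open>N\<close> may exceed the degree, the extra coefficients being zero, so
  that polynomials of different degrees can be compared over a common range of summation.\<close>

lemma poly_mat_eq_mat:
  assumes A: "A \<in> carrier_mat n n" and N: "degree p \<le> N"
  shows "poly_mat p A = mat n n (\<lambda>(i, j). \<Sum>l\<le>N. coeff p l * (A ^\<^sub>m l) $$ (i, j))"
proof -
  have "(\<Sum>l\<leftarrow>[0..<Suc (degree p)]. coeff p l * (A ^\<^sub>m l) $$ ij) =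
    (\<Sum>l\<le>N. coeff p l * (A ^\<^sub>m l) $$ ij)" for ij
  proof -
    have "(\<Sum>l\<leftarrow>[0..<Suc (degree p)]. coeff p l * (A ^\<^sub>m l) $$ ij) =
        (\<Sum>l\<in>{..degree p}. coeff p l * (A ^\<^sub>m l) $$ ij)"
      by (subst interv_sum_list_conv_sum_set_nat) (simp only: set_upt atLeast0LessThan lessThan_Suc_atMost)
    also have "\<dots> = (\<Sum>l\<le>N. coeff p l * (A ^\<^sub>m l) $$ ij)"
      using N by (intro sum.mono_neutral_left) (auto simp: coeff_eq_0)
    finally show ?thesis .
  qed
  then show ?thesis
    using foldr_poly_mat_eq[OF A, of "coeff p" "[0..<Suc (degree p)]"] A
    unfolding poly_mat_def by auto
qed

lemma poly_mat_carrier: "A \<in> carrier_mat n n \<Longrightarrow> poly_mat p A \<in> carrier_mat n n"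
  using poly_mat_eq_mat[of A n p "degree p"] by simp

lemma poly_mat_0: "A \<in> carrier_mat n n \<Longrightarrow> poly_mat 0 A = 0\<^sub>m n n"
  using poly_mat_eq_mat[of A n 0 0] by (auto intro!: eq_matI)

lemma poly_mat_add:
  assumes A: "A \<in> carrier_mat n n"
  shows "poly_mat (p + q) A = poly_mat p A + poly_mat q A"
  by (subst (1 2 3) poly_mat_eq_mat[OF A, of _ "max (degree p) (degree q)"])
    (auto intro!: eq_matI degree_add_le simp: sum.distrib algebra_simps)

lemma poly_mat_smult:
  assumes A: "A \<in> carrier_mat n n"
  shows "poly_mat (Polynomial.smult a p) A = a \<cdot>\<^sub>m poly_mat p A"
  by (subst (1 2) poly_mat_eq_mat[OF A, of _ "degree p"])
    (auto intro!: eq_matI degree_smult_le simp: sum_distrib_left algebra_simps)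

text \<open>Horner's rule. The facts below on products, on intertwining and on stable codes are
  inductions along it and never return to matrix entries.\<close>

lemma poly_mat_pCons:
  assumes A: "A \<in> carrier_mat n n"
  shows "poly_mat (pCons a p) A = a \<cdot>\<^sub>m 1\<^sub>m n + poly_mat p A * A"
proof (rule eq_matI)
  let ?N = "degree p"
  fix i j assume "i < dim_row (a \<cdot>\<^sub>m 1\<^sub>m n + poly_mat p A * A)"
    "j < dim_col (a \<cdot>\<^sub>m 1\<^sub>m n + poly_mat p A * A)"
  then have i: "i < n" and j: "j < n" using A poly_mat_carrier[OF A, of p] by auto
  have pw: "A ^\<^sub>m l \<in> carrier_mat n n" for l by (rule pow_carrier_mat[OF A])
  have "poly_mat (pCons a p) A $$ (i, j) =
      (\<Sum>l\<le>Suc ?N. coeff (pCons a p) l * (A ^\<^sub>m l) $$ (i, j))"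
    using i j by (subst poly_mat_eq_mat[OF A, of _ "Suc ?N"]) (auto simp: degree_pCons_le)
  also have "\<dots> = a * (1\<^sub>m n $$ (i, j)) + (\<Sum>l\<le>?N. coeff p l * (A ^\<^sub>m l * A) $$ (i, j))"
    using A by (subst sum.atMost_Suc_shift) simp
  also have "(\<Sum>l\<le>?N. coeff p l * (A ^\<^sub>m l * A) $$ (i, j)) =
      (\<Sum>l\<le>?N. \<Sum>k\<in>{0..<n}. coeff p l * (A ^\<^sub>m l) $$ (i, k) * A $$ (k, j))"
    using i j A pw
    by (intro sum.cong refl) (auto simp: scalar_prod_def sum_distrib_left mult.assoc intro!: sum.cong)
  also have "\<dots> = (\<Sum>k\<in>{0..<n}. (\<Sum>l\<le>?N. coeff p l * (A ^\<^sub>m l) $$ (i, k)) * A $$ (k, j))"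
    by (subst sum.swap) (simp add: sum_distrib_right)
  also have "\<dots> = (poly_mat p A * A) $$ (i, j)"
    using i j A by (subst poly_mat_eq_mat[OF A, of p ?N])
      (auto simp: scalar_prod_def intro!: sum.cong)
  finally show "poly_mat (pCons a p) A $$ (i, j) = (a \<cdot>\<^sub>m 1\<^sub>m n + poly_mat p A * A) $$ (i, j)"
    using i j A poly_mat_carrier[OF A, of p] by auto
qed (use A poly_mat_carrier[OF A, of p] poly_mat_carrier[OF A, of "pCons a p"] in auto)

lemma poly_mat_1:
  assumes A: "A \<in> carrier_mat n n"
  shows "poly_mat 1 A = 1\<^sub>m n"
  using poly_mat_pCons[OF A, of 1 0] A by (auto simp: poly_mat_0 one_pCons intro!: eq_matI)

lemma poly_mat_commute:
  assumes A: "A \<in> carrier_mat n n"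
  shows "A * poly_mat p A = poly_mat p A * A"
proof (induction p)
  case 0
  then show ?case using A by (simp add: poly_mat_0)
next
  case (pCons a p)
  let ?P = "poly_mat p A"
  have P: "?P \<in> carrier_mat n n" using A by (simp add: poly_mat_carrier)
  have "A * (a \<cdot>\<^sub>m 1\<^sub>m n + ?P * A) = A * (a \<cdot>\<^sub>m 1\<^sub>m n) + A * (?P * A)"
    using A P by (intro mult_add_distrib_mat) auto
  also have "A * (a \<cdot>\<^sub>m 1\<^sub>m n) = a \<cdot>\<^sub>m 1\<^sub>m n * A" using A by auto
  also have "A * (?P * A) = ?P * A * A"
    using assoc_mult_mat[OF A P A] pCons.IH by simp
  also have "a \<cdot>\<^sub>m 1\<^sub>m n * A + ?P * A * A = (a \<cdot>\<^sub>m 1\<^sub>m n + ?P * A) * A"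
    using A P by (intro add_mult_distrib_mat[symmetric]) auto
  finally show ?case using poly_mat_pCons[OF A] by simp
qed

lemma poly_mat_mult:
  assumes A: "A \<in> carrier_mat n n"
  shows "poly_mat (p * q) A = poly_mat p A * poly_mat q A"
proof (induction p)
  case 0
  then show ?case using A poly_mat_carrier[OF A, of q] by (simp add: poly_mat_0)
next
  case (pCons a p)
  let ?P = "poly_mat p A" and ?Q = "poly_mat q A"
  have P: "?P \<in> carrier_mat n n" and Q: "?Q \<in> carrier_mat n n" using A by (simp_all add: poly_mat_carrier)
  have "poly_mat (pCons a p * q) A = a \<cdot>\<^sub>m ?Q + poly_mat (pCons 0 (p * q)) A"
    using A by (simp add: poly_mat_add poly_mat_smult)
  also have "poly_mat (pCons 0 (p * q)) A = ?P * ?Q * A"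
    using A P Q pCons.IH by (subst poly_mat_pCons) auto
  also have "\<dots> = ?P * A * ?Q" 
    using assoc_mult_mat[OF P Q A] assoc_mult_mat[OF P A Q] poly_mat_commute[OF A, of q] by simp
  also have "a \<cdot>\<^sub>m ?Q = a \<cdot>\<^sub>m 1\<^sub>m n * ?Q" using Q by auto
  also have "a \<cdot>\<^sub>m 1\<^sub>m n * ?Q + ?P * A * ?Q = (a \<cdot>\<^sub>m 1\<^sub>m n + ?P * A) * ?Q"
    using A P Q by (intro add_mult_distrib_mat[symmetric]) auto
  finally show ?case using poly_mat_pCons[OF A] by simp
qed

lemma poly_mat_dvd_zero:
  assumes A: "A \<in> carrier_mat n n" and "p dvd q" and p: "poly_mat p A = 0\<^sub>m n n"
  shows "poly_mat q A = 0\<^sub>m n n"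
proof -
  obtain k where "q = p * k" using \<open>p dvd q\<close> by (elim dvdE)
  then show ?thesis using p left_mult_zero_mat[OF poly_mat_carrier[OF A]]
    by (simp add: poly_mat_mult[OF A])
qed

text \<open>Meant for \<open>T\<close> whose columns are a basis of an invariant subspace of
  \<open>A\<close>, with \<open>B\<close> the matrix of the restriction in that basis.\<close>

lemma poly_mat_intertwine:
  assumes A: "A \<in> carrier_mat n n" and B: "B \<in> carrier_mat d d" and T: "T \<in> carrier_mat n d"
    and AT: "A * T = T * B"
  shows "poly_mat p A * T = T * poly_mat p B"
proof (induction p)
  case 0
  then show ?case using A B T by (simp add: poly_mat_0)
next
  case (pCons a p)
  let ?P = "poly_mat p A" and ?Q = "poly_mat p B"
  have P: "?P \<in> carrier_mat n n" and Q: "?Q \<in> carrier_mat d d" using A B by (simp_all add: poly_mat_carrier)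
  have "(a \<cdot>\<^sub>m 1\<^sub>m n + ?P * A) * T = a \<cdot>\<^sub>m 1\<^sub>m n * T + ?P * A * T"
    using A P T by (intro add_mult_distrib_mat) auto
  also have "a \<cdot>\<^sub>m 1\<^sub>m n * T = T * (a \<cdot>\<^sub>m 1\<^sub>m d)" using T by auto
  also have "?P * A * T = T * (?Q * B)"
    using assoc_mult_mat[OF P A T] assoc_mult_mat[OF P T B] assoc_mult_mat[OF T Q B] AT pCons.IH
    by simp
  also have "T * (a \<cdot>\<^sub>m 1\<^sub>m d) + T * (?Q * B) = T * (a \<cdot>\<^sub>m 1\<^sub>m d + ?Q * B)"
    using B Q T by (intro mult_add_distrib_mat[symmetric]) auto
  finally show ?case using poly_mat_pCons[OF A] poly_mat_pCons[OF B] by simp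
qed

section \<open>Characteristic polynomials of annihilated matrices and of restrictions\<close>

text \<open>Right division of \<open>p\<close> times the identity by x - \<open>A\<close>, with
  remainder \<open>poly_mat p A\<close>. In the induction step the remainder P is multiplied by x,
  and x P = P (x - A) + P A holds for the constant matrix P: the first summand joins the quotient
  and the second is the new remainder, up to the constant coefficient.\<close>

lemma poly_scaled_one_eq:
  fixes A :: "'a :: comm_ring_1 mat"
  assumes A: "A \<in> carrier_mat n n"
  shows "\<exists>Q\<in>carrier_mat n n.
    p \<cdot>\<^sub>m 1\<^sub>m n = map_mat (\<lambda>a. [:a:]) (poly_mat p A) + Q * char_poly_matrix A"
proof (induction p)
  case 0
  have "0 \<cdot>\<^sub>m 1\<^sub>m n = map_mat (\<lambda>a. [:a:]) (poly_mat 0 A) + 0\<^sub>m n n * char_poly_matrix A"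
    using A by (auto intro!: eq_matI simp: poly_mat_0 char_poly_matrix_def)
  then show ?case by (intro bexI[of _ "0\<^sub>m n n"]) auto
next
  case (pCons a p)
  let ?c = "map_mat (\<lambda>a :: 'a. [:a:])" and ?X = "[:0, 1:] :: 'a poly" and ?C = "char_poly_matrix A"
  let ?P = "poly_mat p A"
  from pCons.IH obtain Q where Q: "Q \<in> carrier_mat n n" and eq: "p \<cdot>\<^sub>m 1\<^sub>m n = ?c ?P + Q * ?C" by auto
  have C: "?C \<in> carrier_mat n n" using A by simp
  have P: "?P \<in> carrier_mat n n" using A by (simp add: poly_mat_carrier)
  have cP: "?c ?P \<in> carrier_mat n n" using P by simp
  have QC: "Q * ?C \<in> carrier_mat n n" using Q C by simp
  have rearrange: "W + ((X + Y) + Z) = (W + Y) + (X + Z)"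
    if "W \<in> carrier_mat n n" "X \<in> carrier_mat n n" "Y \<in> carrier_mat n n" "Z \<in> carrier_mat n n"
    for W X Y Z :: "'a poly mat"
    using that by (auto intro!: eq_matI)
  have X1: "?X \<cdot>\<^sub>m 1\<^sub>m n = ?C + ?c A"
    using A by (auto intro!: eq_matI simp: char_poly_matrix_def)
  have "?X \<cdot>\<^sub>m ?c ?P = ?c ?P * (?X \<cdot>\<^sub>m 1\<^sub>m n)" using P by auto
  also have "\<dots> = ?c ?P * ?C + ?c ?P * ?c A" unfolding X1
    by (rule mult_add_distrib_mat[OF cP C]) (use A in simp)
  also have "?c ?P * ?c A = ?c (?P * A)" using map_poly_mult(1)[OF P A] by simp
  finally have XP: "?X \<cdot>\<^sub>m ?c ?P = ?c ?P * ?C + ?c (?P * A)" .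
  have "pCons a p \<cdot>\<^sub>m 1\<^sub>m n = [:a:] \<cdot>\<^sub>m 1\<^sub>m n + ?X \<cdot>\<^sub>m (p \<cdot>\<^sub>m 1\<^sub>m n)"
    by (auto intro!: eq_matI)
  also have "\<dots> = [:a:] \<cdot>\<^sub>m 1\<^sub>m n + (?X \<cdot>\<^sub>m ?c ?P + ?X \<cdot>\<^sub>m (Q * ?C))"
    unfolding eq using add_smult_distrib_left_mat[OF cP QC] by simp
  also have "?X \<cdot>\<^sub>m (Q * ?C) = ?X \<cdot>\<^sub>m Q * ?C" using mult_smult_assoc_mat[OF Q C] by simp
  also have "[:a:] \<cdot>\<^sub>m 1\<^sub>m n + (?X \<cdot>\<^sub>m ?c ?P + ?X \<cdot>\<^sub>m Q * ?C) =
      ([:a:] \<cdot>\<^sub>m 1\<^sub>m n + ?c (?P * A)) + (?c ?P * ?C + ?X \<cdot>\<^sub>m Q * ?C)"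
    unfolding XP by (rule rearrange) (use Q C P A in \<open>auto intro!: mult_carrier_mat[of _ n n]\<close>)
  also have "[:a:] \<cdot>\<^sub>m 1\<^sub>m n + ?c (?P * A) = ?c (poly_mat (pCons a p) A)"
    unfolding poly_mat_pCons[OF A] using P A by (auto intro!: eq_matI)
  also have "?c ?P * ?C + ?X \<cdot>\<^sub>m Q * ?C = (?c ?P + ?X \<cdot>\<^sub>m Q) * ?C"
    by (rule add_mult_distrib_mat[symmetric, OF cP _ C]) (use Q in simp)
  finally show ?case by (rule bexI) (use Q cP in auto)
qed

text \<open>The division above leaves no remainder, and determinants turn it into
  \<open>p ^ n = det Q * char_poly A\<close>.\<close>

lemma char_poly_dvd_power:
  fixes A :: "'a :: comm_ring_1 mat"
  assumes A: "A \<in> carrier_mat n n" and p: "poly_mat p A = 0\<^sub>m n n"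
  shows "char_poly A dvd p ^ n"
proof -
  obtain Q where Q: "Q \<in> carrier_mat n n"
    and eq: "p \<cdot>\<^sub>m 1\<^sub>m n = map_mat (\<lambda>a. [:a:]) (poly_mat p A) + Q * char_poly_matrix A"
    using poly_scaled_one_eq[OF A] by blast
  have C: "char_poly_matrix A \<in> carrier_mat n n" using A by simp
  have "p \<cdot>\<^sub>m 1\<^sub>m n = Q * char_poly_matrix A"
    unfolding eq p using Q C by (auto intro!: eq_matI)
  then have "det (p \<cdot>\<^sub>m 1\<^sub>m n) = det Q * char_poly A"
    using det_mult[OF Q C] by (simp add: char_poly_def)
  then show ?thesis by (simp add: det_smult)
qed

lemma char_poly_four_block_lower_left_zero:
  fixes A :: "'a :: idom mat"
  assumes A: "A \<in> carrier_mat d d" and B: "B \<in> carrier_mat d e" and D: "D \<in> carrier_mat e e"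
  shows "char_poly (four_block_mat A B (0\<^sub>m e d) D) = char_poly A * char_poly D"
proof -
  have "char_poly_matrix (four_block_mat A B (0\<^sub>m e d) D) =
    four_block_mat (char_poly_matrix A) (map_mat (\<lambda>a. [:- a:]) B) (0\<^sub>m e d) (char_poly_matrix D)"
    by (rule eq_matI) (use A B D in \<open>auto simp: char_poly_matrix_def\<close>)
  then show ?thesis unfolding char_poly_def
    by (simp, subst det_four_block_mat_lower_left_zero) (use A B D in auto)
qed

lemma mult_mat_unit_vec:
  fixes A :: "'a :: comm_ring_1 mat"
  assumes A: "A \<in> carrier_mat n d" and j: "j < d"
  shows "A *\<^sub>v unit_vec d j = col A j"
  using col_mult2[OF A one_carrier_mat j] right_mult_one_mat[OF A] j by simp

text \<open>The rows of \<open>P\<close> span an invariant subspace on which \<open>M\<close> acts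
  as \<open>A\<close>. Completing them to a basis makes \<open>M\<close> similar to a block upper
  triangular matrix whose first diagonal block is \<open>A\<close>.\<close>

lemma char_poly_dvd_of_invariant:
  fixes M :: "'a :: field mat"
  assumes M: "M \<in> carrier_mat n n" and P: "P \<in> carrier_mat d n" and A: "A \<in> carrier_mat d d"
    and dist: "distinct (rows P)" and li: "vlin_indpt n (set (rows P))"
    and MP: "M * P\<^sup>T = P\<^sup>T * A"
  shows "char_poly A dvd char_poly M"
proof -
  interpret vec_space "TYPE('a)" n .
  have Pc: "set (rows P) \<subseteq> carrier_vec n" using P by (auto simp: rows_def)
  have cardP: "card (set (rows P)) = d" using distinct_card[OF dist] P by simp
  have cardu: "card (set (unit_vecs n)) = n" using distinct_card[OF unit_vecs_distinct] by simp
  \<comment> \<open>Steinitz exchange against the unit vectors: at most \<open>n - d\<close> further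
    vectors complete the rows of \<open>P\<close> to a spanning set. A spanning set has at least
    \<open>n\<close> elements, so the list \<open>ws\<close> below has length exactly
    \<open>n\<close>.\<close>
  obtain Cs where Cs: "finite Cs" "Cs \<subseteq> carrier_vec n"
    "int (card Cs) \<le> int n - int d" "span (set (rows P) \<union> Cs) = carrier_vec n"
  proof -
    have "set (rows P) \<subseteq> span (set (unit_vecs n))" unfolding span_unit_vecs_is_carrier by (rule Pc)
    moreover have "lin_indpt (set (rows P))" using li by (simp add: vlin_indpt_def)
    moreover have "set (unit_vecs n) \<subseteq> carrier V" using unit_vecs_carrier by simp
    ultimately show thesis
      using replacement[of "set (rows P)" "set (unit_vecs n)"] that
      unfolding span_unit_vecs_is_carrier cardP cardu cV by blast
  qed
  obtain cs where cs: "set cs = Cs" "distinct cs" using finite_distinct_list[OF Cs(1)] by blast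
  define ws where "ws = rows P @ cs"
  have ws: "set ws \<subseteq> carrier_vec n" "span (set ws) = carrier_vec n" using Pc Cs cs by (auto simp: ws_def)
  have "dim \<le> card (set ws)" by (rule gen_ge_dim) (use ws in auto)
  then have "n \<le> length ws" using card_length[of ws] dim_is_n by simp
  moreover have lws: "length ws = d + card Cs" using cs distinct_card[of cs] P by (simp add: ws_def)
  ultimately have len: "length ws = n" and dn: "d \<le> n" using Cs(3) by auto
  define S where "S = mat_of_cols n ws"
  have S: "S \<in> carrier_mat n n" using mat_of_cols_carrier(1)[of n ws] len by (simp add: S_def)
  have St: "S\<^sup>T \<in> carrier_mat n n" using S by simp
  have "rows S\<^sup>T = ws" using ws(1) by (simp add: S_def)
  then have "(*\<^sub>v) S ` carrier_vec n = carrier_vec n"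
    using vspan_rows[OF St] ws(2) by (simp add: vspan_def)
  then have "unit_vec n j \<in> (*\<^sub>v) S ` carrier_vec n" for j by simp
  then have "\<forall>j. \<exists>x. x \<in> carrier_vec n \<and> S *\<^sub>v x = unit_vec n j" by (metis imageE)
  then obtain x where x: "\<And>j. x j \<in> carrier_vec n \<and> S *\<^sub>v x j = unit_vec n j" by metis
  define X where "X = mat_of_cols n (map x [0..<n])"
  have X: "X \<in> carrier_mat n n" using mat_of_cols_carrier(1)[of n "map x [0..<n]"] by (simp add: X_def)
  have SX: "S * X = 1\<^sub>m n"
  proof (rule eq_matI)
    fix i j assume "i < dim_row (1\<^sub>m n :: 'a mat)" "j < dim_col (1\<^sub>m n :: 'a mat)"
    then have i: "i < n" and j: "j < n" by auto
    have "col X j = x j" using x[of j] j by (simp add: X_def col_mat_of_cols)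
    then have "(S * X) $$ (i, j) = (S *\<^sub>v x j) $ i" using i j S X by simp
    then show "(S * X) $$ (i, j) = 1\<^sub>m n $$ (i, j)" using x[of j] i j by simp
  qed (use S X in auto)
  have XS: "X * S = 1\<^sub>m n" by (rule mat_mult_left_right_inverse[OF S X SX])
  define N where "N = X * M * S"
  have N: "N \<in> carrier_mat n n" using X M S by (simp add: N_def)
  have "S * N * X = M"
  proof -
    have "S * N = S * (X * M) * S" unfolding N_def
      by (rule assoc_mult_mat[OF S mult_carrier_mat[OF X M] S, symmetric])
    also have "S * (X * M) = M" using assoc_mult_mat[OF S X M] SX M by simp
    finally show ?thesis using assoc_mult_mat[OF M S X] SX M by simp
  qed
  then have "similar_mat M N" by (intro similar_matI[of _ _ S X n]) (use S X M N SX XS in auto)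
  then have chi: "char_poly M = char_poly N" by (rule char_poly_similar)
  \<comment> \<open>\<open>J\<close> consists of the first \<open>d\<close> columns of the identity:
    \<open>Y * J\<close> keeps the first \<open>d\<close> columns of \<open>Y\<close>, and
    \<open>J * A\<close> is \<open>A\<close> on top of zero rows. The equation
    \<open>N * J = J * A\<close> thus reads off the two left blocks of \<open>N\<close>.\<close>
  define J where "J = mat n d (\<lambda>(i, j). if i = j then 1 else 0 :: 'a)"
  have J: "J \<in> carrier_mat n d" by (simp add: J_def)
  have mulJ: "(Y * J) $$ (i, j) = Y $$ (i, j)" if "Y \<in> carrier_mat n n" "i < n" "j < d" for Y i j
  proof -
    have "(Y * J) $$ (i, j) = (\<Sum>k = 0..<n. Y $$ (i, k) * (if k = j then 1 else 0))"
      using that by (simp add: J_def scalar_prod_def)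
    also have "\<dots> = (\<Sum>k = 0..<n. if k = j then Y $$ (i, k) else 0)" by (rule sum.cong) auto
    finally show ?thesis using that dn by simp
  qed
  have Jmul: "(J * A) $$ (i, j) = (if i < d then A $$ (i, j) else 0)" if "i < n" "j < d" for i j
  proof -
    have "(J * A) $$ (i, j) = (\<Sum>k = 0..<d. (if i = k then 1 else 0) * A $$ (k, j))"
      using that A by (simp add: J_def scalar_prod_def)
    also have "\<dots> = (\<Sum>k = 0..<d. if i = k then A $$ (k, j) else 0)" by (rule sum.cong) auto
    finally show ?thesis using that by simp
  qed
  have SJ: "S * J = P\<^sup>T"
  proof (rule eq_matI)
    fix i j assume "i < dim_row P\<^sup>T" "j < dim_col P\<^sup>T"
    then have ij: "i < n" "j < d" using P by auto
    have "(S * J) $$ (i, j) = S $$ (i, j)" using mulJ[OF S ij] .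
    also have "\<dots> = ws ! j $ i" unfolding S_def
      by (rule mat_of_cols_index) (use ij dn len in auto)
    also have "\<dots> = P\<^sup>T $$ (i, j)" using ij P by (simp add: ws_def nth_append)
    finally show "(S * J) $$ (i, j) = P\<^sup>T $$ (i, j)" .
  qed (use S J P in auto)
  have Pt: "P\<^sup>T \<in> carrier_mat n d" using P by simp
  have XP: "X * P\<^sup>T = J" unfolding SJ[symmetric] assoc_mult_mat[OF X S J, symmetric] XS
    by (rule left_mult_one_mat[OF J])
  have "N * J = X * M * (S * J)" unfolding N_def
    by (rule assoc_mult_mat[OF mult_carrier_mat[OF X M] S J])
  also have "\<dots> = X * (M * P\<^sup>T)" unfolding SJ by (rule assoc_mult_mat[OF X M Pt])
  also have "\<dots> = X * P\<^sup>T * A" unfolding MP by (rule assoc_mult_mat[OF X Pt A, symmetric])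
  finally have NJ: "N * J = J * A" unfolding XP .
  have Nij: "N $$ (i, j) = (if i < d then A $$ (i, j) else 0)" if "i < n" "j < d" for i j
    using mulJ[OF N that] Jmul[OF that] NJ by simp
  let ?B = "mat d (n - d) (\<lambda>(i, j). N $$ (i, j + d))"
  let ?D = "mat (n - d) (n - d) (\<lambda>(i, j). N $$ (i + d, j + d))"
  have "N = four_block_mat A ?B (0\<^sub>m (n - d) d) ?D"
    by (rule eq_matI) (use N A Nij dn in auto)
  then have "char_poly N = char_poly A * char_poly ?D"
    using char_poly_four_block_lower_left_zero[OF A, of ?B "n - d" ?D] by simp
  then show ?thesis using chi by simp
qed

section \<open>Coprimality of powers of distinct irreducible polynomials\<close>

text \<open>An element \<open>h\<close> of least degree in the ideal generated by \<open>f\<close>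
  and \<open>g\<close> divides the whole ideal, by division with remainder. As a divisor of the
  irreducible \<open>f\<close> it is a unit or a multiple of \<open>f\<close>, and the latter would
  make \<open>f\<close> divide \<open>g\<close>.\<close>

lemma bezout_irreducible:
  fixes f g :: "'a :: field poly"
  assumes irr: "irreducible f" and ndvd: "\<not> f dvd g"
  shows "\<exists>u v. u * f + v * g = 1"
proof -
  define I where "I = {h. h \<noteq> 0 \<and> (\<exists>u v. h = u * f + v * g)}"
  have f0: "f \<noteq> 0" using irr by auto
  have "f = 1 * f + 0 * g" by simp
  then have "f \<in> I" unfolding I_def using f0 by blast
  then have "\<exists>h. h \<in> I \<and> (\<forall>h'. h' \<in> I \<longrightarrow> degree h \<le> degree h')" by (rule ex_has_least_nat)
  then obtain h where h: "h \<in> I" and min: "\<And>h'. h' \<in> I \<Longrightarrow> degree h \<le> degree h'" by blast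
  from h obtain u v where uv: "h = u * f + v * g" and h0: "h \<noteq> 0" unfolding I_def by blast
  have dvd: "h dvd a * f + b * g" for a b
  proof (rule ccontr)
    assume n: "\<not> h dvd a * f + b * g"
    let ?x = "a * f + b * g"
    have "?x mod h = ?x - (?x div h) * h" by (simp add: minus_div_mult_eq_mod)
    also have "\<dots> = (a - (?x div h) * u) * f + (b - (?x div h) * v) * g"
      by (subst (2) uv) (simp add: algebra_simps)
    finally have "\<exists>u v. ?x mod h = u * f + v * g" by (intro exI)
    moreover have "?x mod h \<noteq> 0" using n by (simp add: dvd_eq_mod_eq_0)
    ultimately have "?x mod h \<in> I" unfolding I_def by blast
    then have "degree h \<le> degree (?x mod h)" by (rule min)
    then show False using degree_mod_less_degree[OF h0 n] by simp
  qed
  have "h dvd f" "h dvd g" using dvd[of 1 0] dvd[of 0 1] by simp_all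
  then have "is_unit h" using irreducibleD'[OF irr, of h] ndvd dvd_trans[of f h g] by blast
  then obtain w where "1 = h * w" by (elim dvdE)
  then have "(w * u) * f + (w * v) * g = 1" by (simp add: uv algebra_simps)
  then show ?thesis by (intro exI)
qed

text \<open>The identity for \<open>f ^ e\<close> is multiplied by the one for \<open>f\<close>: of
  the four products only one lacks the factor \<open>g\<close>, and that one is a multiple of
  \<open>f ^ Suc e\<close>.\<close>

lemma bezout_irreducible_power:
  fixes f g :: "'a :: field poly"
  assumes "irreducible f" "\<not> f dvd g"
  shows "\<exists>u v. u * f ^ e + v * g = 1"
proof (induction e)
  case 0
  have "1 * f ^ 0 + 0 * g = 1" by simp
  then show ?case by (intro exI)
next
  case (Suc e)
  obtain u v where uv: "u * f ^ e + v * g = 1" using Suc by (elim exE)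
  obtain a b where ab: "a * f + b * g = 1" using bezout_irreducible[OF assms] by (elim exE)
  have "1 = (u * f ^ e + v * g) * (a * f + b * g)" using uv ab by simp
  also have "\<dots> = (u * a) * f ^ Suc e + (u * f ^ e * b + v * a * f + v * b * g) * g"
    by (simp add: algebra_simps)
  finally show ?case by (intro exI) (rule sym)
qed

lemma prime_elem_dvd_prod:
  fixes g :: "'i \<Rightarrow> 'a :: {algebraic_semidom, comm_semiring_1}"
  assumes "finite I" "prime_elem p" "p dvd prod g I"
  shows "\<exists>i\<in>I. p dvd g i"
  using assms
proof (induction I)
  case empty
  then show ?case by (simp add: prime_elem_def)
next
  case (insert i I)
  then show ?case by (auto simp: prime_elem_dvd_mult_iff)
qed

text \<open>A prime dividing the product divides some other \<open>f j\<close>. Two irreducible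
  polynomials, one dividing the other, are associated, and associated monic polynomials are equal,
  against injectivity.\<close>

lemma irreducible_not_dvd_prod_other:
  fixes f :: "'i \<Rightarrow> 'a :: field poly"
  assumes I: "finite I" and irr: "\<And>i. i \<in> I \<Longrightarrow> monic (f i) \<and> irreducible (f i)"
    and inj: "inj_on f I" and i: "i \<in> I"
  shows "\<not> f i dvd (\<Prod>j\<in>I - {i}. f j ^ e j)"
proof
  assume "f i dvd (\<Prod>j\<in>I - {i}. f j ^ e j)"
  moreover have pr: "prime_elem (f i)" using irr[OF i] field_poly_irreducible_imp_prime by blast
  ultimately obtain j where j: "j \<in> I" "j \<noteq> i" "f i dvd f j ^ e j"
    using prime_elem_dvd_prod[of "I - {i}" "f i" "\<lambda>j. f j ^ e j"] I by auto
  then have "f i dvd f j" using prime_elem_dvd_power[OF pr] by blast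
  moreover have "\<not> is_unit (f i)" using pr by (rule prime_elem_not_unit)
  ultimately have "f j dvd f i" using irreducibleD'[of "f j" "f i"] irr[OF j(1)] by blast
  with \<open>f i dvd f j\<close> have "f i = f j"
    using irr[OF i] irr[OF j(1)] poly_dvd_antisym by metis
  then show False using inj i j by (auto dest: inj_onD)
qed

text \<open>The restriction of \<open>M\<close> to the kernel is annihilated by a power of \<open>f\<close>, so its
  characteristic polynomial divides both a power of \<open>f\<close> and \<open>f ^ N * h\<close>.\<close>
lemma dim_generalized_kernel_le:
  fixes M :: "'a :: field mat"
  assumes M: "M \<in> carrier_mat n n" and P: "P \<in> carrier_mat d n"
    and dist: "distinct (rows P)" and li: "vlin_indpt n (set (rows P))"
    and ker: "vspan n (set (rows P)) = mat_kernel (poly_mat (f ^ e) M)"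
    and inj: "\<And>y. y \<in> carrier_vec d \<Longrightarrow> P\<^sup>T *\<^sub>v y = 0\<^sub>v n \<Longrightarrow> y = 0\<^sub>v d"
    and irr: "irreducible f" and chi: "char_poly M = f ^ N * h" and nd: "\<not> f dvd h"
  shows "d \<le> N * degree f"
proof -
  let ?Q = "poly_mat (f ^ e) M"
  have Q: "?Q \<in> carrier_mat n n" by (rule poly_mat_carrier[OF M])
  have Pt: "P\<^sup>T \<in> carrier_mat n d" using P by simp
  have im: "(*\<^sub>v) P\<^sup>T ` carrier_vec d = mat_kernel ?Q" using ker vspan_rows[OF P] by simp
  have kerM: "M *\<^sub>v v \<in> mat_kernel ?Q" if "v \<in> mat_kernel ?Q" for v
  proof (rule mat_kernelI[OF Q])
    have v: "v \<in> carrier_vec n" "?Q *\<^sub>v v = 0\<^sub>v n" using mat_kernelD[OF Q that] .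
    show "M *\<^sub>v v \<in> carrier_vec n" using M v by simp
    have "?Q *\<^sub>v (M *\<^sub>v v) = M *\<^sub>v (?Q *\<^sub>v v)"
      using assoc_mult_mat_vec[OF Q M v(1)] assoc_mult_mat_vec[OF M Q v(1)] poly_mat_commute[OF M, of "f ^ e"]
      by simp
    then show "?Q *\<^sub>v (M *\<^sub>v v) = 0\<^sub>v n" using v M by auto
  qed
  have unit: "P\<^sup>T *\<^sub>v unit_vec d j \<in> mat_kernel ?Q" for j unfolding im[symmetric] by simp
  then have "M *\<^sub>v (P\<^sup>T *\<^sub>v unit_vec d j) \<in> (*\<^sub>v) P\<^sup>T ` carrier_vec d" for j using kerM im by simp
  then have "\<forall>j. \<exists>y. y \<in> carrier_vec d \<and> P\<^sup>T *\<^sub>v y = M *\<^sub>v (P\<^sup>T *\<^sub>v unit_vec d j)" by (metis imageE)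
  then obtain y where y: "\<And>j. y j \<in> carrier_vec d \<and> P\<^sup>T *\<^sub>v y j = M *\<^sub>v (P\<^sup>T *\<^sub>v unit_vec d j)"
    by metis
  \<comment> \<open>The matrix of \<open>M\<close> restricted to the kernel, in the basis given by
    the rows of \<open>P\<close>.\<close>
  define A where "A = mat_of_cols d (map y [0..<d])"
  have A: "A \<in> carrier_mat d d" unfolding A_def using mat_of_cols_carrier(1)[of d "map y [0..<d]"] by simp
  have MP: "M * P\<^sup>T = P\<^sup>T * A"
  proof (rule mat_col_eqI)
    fix j assume "j < dim_col (P\<^sup>T * A)"
    then have j: "j < d" using A by simp
    have "col A j = y j" using y[of j] j by (simp add: A_def col_mat_of_cols)
    then have "col (P\<^sup>T * A) j = P\<^sup>T *\<^sub>v y j" using col_mult2[OF Pt A j] by simp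
    also have "\<dots> = M *\<^sub>v (P\<^sup>T *\<^sub>v unit_vec d j)" using y by blast
    also have "P\<^sup>T *\<^sub>v unit_vec d j = col P\<^sup>T j" by (rule mult_mat_unit_vec[OF Pt j])
    finally show "col (M * P\<^sup>T) j = col (P\<^sup>T * A) j" using j col_mult2[OF M Pt] by simp
  qed (use M Pt A in auto)
  \<comment> \<open>The transpose of \<open>P\<close> is injective, so a column may be tested after
    applying it; there it becomes the value of \<open>?Q\<close> on a vector of the kernel of
    \<open>?Q\<close>.\<close>
  have "poly_mat (f ^ e) A = 0\<^sub>m d d"
  proof (rule mat_col_eqI)
    fix j assume "j < dim_col (0\<^sub>m d d :: 'a mat)"
    then have j: "j < d" by simp
    have pA: "poly_mat (f ^ e) A \<in> carrier_mat d d" by (rule poly_mat_carrier[OF A])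
    let ?c = "col (poly_mat (f ^ e) A) j"
    have c: "?c \<in> carrier_vec d" using pA j by auto
    have "P\<^sup>T *\<^sub>v ?c = col (P\<^sup>T * poly_mat (f ^ e) A) j" using j col_mult2[OF Pt pA] by simp
    also have "\<dots> = col (?Q * P\<^sup>T) j" using poly_mat_intertwine[OF M A Pt MP] by simp
    also have "\<dots> = ?Q *\<^sub>v (P\<^sup>T *\<^sub>v unit_vec d j)"
      using j col_mult2[OF Q Pt] mult_mat_unit_vec[OF Pt] by simp
    also have "\<dots> = 0\<^sub>v n" by (rule mat_kernelD(2)[OF Q unit])
    finally have "?c = 0\<^sub>v d" by (rule inj[OF c])
    then show "?c = col (0\<^sub>m d d) j" using j by simp
  qed (use A poly_mat_carrier[OF A] in auto)
  then have d1: "char_poly A dvd (f ^ e) ^ d" by (rule char_poly_dvd_power[OF A])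
  have d2: "char_poly A dvd f ^ N * h" using char_poly_dvd_of_invariant[OF M P A dist li MP] chi by simp
  \<comment> \<open>\<open>(f ^ e) ^ d\<close> is coprime to \<open>h\<close>. Multiplying the
    identity by \<open>f ^ N\<close> expresses \<open>f ^ N\<close> through two known multiples of
    \<open>char_poly A\<close>, which removes \<open>h\<close>; the degree of
    \<open>char_poly A\<close> is \<open>d\<close>.\<close>
  obtain u v where uv: "u * (f ^ e) ^ d + v * h = 1"
    using bezout_irreducible_power[OF irr nd, of "e * d"] by (auto simp: power_mult)
  have "f ^ N = u * f ^ N * (f ^ e) ^ d + v * (f ^ N * h)"
    using arg_cong[OF uv, of "\<lambda>x. x * f ^ N"] by (simp add: algebra_simps)
  then have "char_poly A dvd f ^ N" using dvd_add[OF dvd_mult[OF d1, of "u * f ^ N"] dvd_mult[OF d2, of v]] by simp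
  moreover have f0: "f \<noteq> 0" using irr by auto
  ultimately have "degree (char_poly A) \<le> degree (f ^ N)" by (intro dvd_imp_degree_le) auto
  then show ?thesis using degree_monic_char_poly[OF A] f0 by (simp add: degree_power_eq mult.commute)
qed

subsection \<open>Rank support and generalized rank weights\<close>

locale ordered_field_extension =
  fixes \<iota> :: "'k :: field \<Rightarrow> 'l :: field" and B :: "'l list"
  assumes hom: "field_hom \<iota>" and basis: "ordered_basis \<iota> B"
begin

interpretation \<iota>: field_hom \<iota> by (rule hom)

abbreviation ext :: "'k mat \<Rightarrow> 'l mat" where "ext \<equiv> map_mat \<iota>"

lemma coord_carrier: "coord \<iota> B x \<in> carrier_vec (length B)"
  and coord_expansion: "x = (\<Sum>j<length B. \<iota> (coord \<iota> B x $ j) * B ! j)"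
  using theI'[OF basis[unfolded ordered_basis_def, rule_format, of x]] unfolding coord_def by auto

lemma coord_unique:
  assumes "a \<in> carrier_vec (length B)" "x = (\<Sum>j<length B. \<iota> (a $ j) * B ! j)"
  shows "coord \<iota> B x = a"
  using basis[unfolded ordered_basis_def, rule_format, of x] assms coord_carrier coord_expansion
  by blast

lemma coord_add: "coord \<iota> B (x + y) = coord \<iota> B x + coord \<iota> B y"
proof (rule coord_unique)
  show "coord \<iota> B x + coord \<iota> B y \<in> carrier_vec (length B)" using coord_carrier by simp
  have "x + y = (\<Sum>j<length B. \<iota> (coord \<iota> B x $ j) * B ! j) + (\<Sum>j<length B. \<iota> (coord \<iota> B y $ j) * B ! j)"
    using coord_expansion[of x] coord_expansion[of y] by (rule arg_cong2)
  also have "\<dots> = (\<Sum>j<length B. \<iota> ((coord \<iota> B x + coord \<iota> B y) $ j) * B ! j)"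
    unfolding sum.distrib[symmetric] using coord_carrier[of y]
    by (intro sum.cong) (auto simp: \<iota>.hom_add algebra_simps)
  finally show "x + y = (\<Sum>j<length B. \<iota> ((coord \<iota> B x + coord \<iota> B y) $ j) * B ! j)" .
qed

lemma coord_smult: "coord \<iota> B (\<iota> a * x) = a \<cdot>\<^sub>v coord \<iota> B x"
proof (rule coord_unique)
  show "a \<cdot>\<^sub>v coord \<iota> B x \<in> carrier_vec (length B)" using coord_carrier by simp
  have "\<iota> a * x = \<iota> a * (\<Sum>j<length B. \<iota> (coord \<iota> B x $ j) * B ! j)"
    using coord_expansion[of x] by (rule arg_cong)
  also have "\<dots> = (\<Sum>j<length B. \<iota> ((a \<cdot>\<^sub>v coord \<iota> B x) $ j) * B ! j)"
    unfolding sum_distrib_left using coord_carrier[of x]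
    by (intro sum.cong) (auto simp: \<iota>.hom_mult algebra_simps)
  finally show "\<iota> a * x = (\<Sum>j<length B. \<iota> ((a \<cdot>\<^sub>v coord \<iota> B x) $ j) * B ! j)" .
qed

lemma coord_0: "coord \<iota> B 0 = 0\<^sub>v (length B)"
  by (rule coord_unique) auto

lemma coord_sum:
  assumes "finite S" "j < length B"
  shows "coord \<iota> B (\<Sum>k\<in>S. \<iota> (a k) * x k) $ j = (\<Sum>k\<in>S. a k * coord \<iota> B (x k) $ j)"
  using assms(1)
proof induction
  case (insert k S)
  have d: "dim_vec (coord \<iota> B z) = length B" for z using coord_carrier by auto
  show ?case using insert assms(2) by (simp add: coord_add coord_smult d)
qed (use assms(2) in \<open>simp add: coord_0\<close>)

text \<open>Row \<open>j\<close> of \<open>MB \<iota> B c\<close>, obtained by applying the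
  \<open>j\<close>-th coordinate functional to every entry. In this form the generators of the
  support are images of \<open>c\<close> under K-linear maps.\<close>

definition coord_vec :: "nat \<Rightarrow> 'l vec \<Rightarrow> 'k vec" where
  "coord_vec j c = vec (dim_vec c) (\<lambda>i. coord \<iota> B (c $ i) $ j)"

lemma coord_vec_carrier: "c \<in> carrier_vec n \<Longrightarrow> coord_vec j c \<in> carrier_vec n"
  by (auto simp: coord_vec_def)

text \<open>Coordinate functionals are K-linear and the entries of \<open>A\<close> lie in K. The
  passage between L^n and K^n rests on this commutation.\<close>

lemma coord_vec_mult:
  assumes A: "A \<in> carrier_mat p n" and c: "c \<in> carrier_vec n" and j: "j < length B"
  shows "coord_vec j (ext A *\<^sub>v c) = A *\<^sub>v coord_vec j c"
proof (rule eq_vecI)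
  fix i assume "i < dim_vec (A *\<^sub>v coord_vec j c)"
  then have i: "i < p" using A by simp
  have "(ext A *\<^sub>v c) $ i = (\<Sum>k\<in>{0..<n}. \<iota> (A $$ (i, k)) * c $ k)"
    using A c i by (auto simp: scalar_prod_def intro!: sum.cong)
  then have "coord_vec j (ext A *\<^sub>v c) $ i = (\<Sum>k\<in>{0..<n}. A $$ (i, k) * coord \<iota> B (c $ k) $ j)"
    using i A j by (simp add: coord_vec_def coord_sum)
  also have "\<dots> = (A *\<^sub>v coord_vec j c) $ i"
    using A c i by (auto simp: scalar_prod_def coord_vec_def intro!: sum.cong)
  finally show "coord_vec j (ext A *\<^sub>v c) $ i = (A *\<^sub>v coord_vec j c) $ i" .
qed (use A in \<open>simp add: coord_vec_def\<close>)

lemma coord_vec_zero: "j < length B \<Longrightarrow> coord_vec j (0\<^sub>v n) = 0\<^sub>v n"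
  by (auto simp: coord_vec_def coord_0 intro!: eq_vecI)

lemma coord_vec_inject:
  assumes c: "c \<in> carrier_vec n" "c' \<in> carrier_vec n"
    and eq: "\<And>j. j < length B \<Longrightarrow> coord_vec j c = coord_vec j c'"
  shows "c = c'"
proof (rule eq_vecI)
  fix i assume "i < dim_vec c'"
  then have i: "i < n" using c by simp
  have "coord \<iota> B (c $ i) $ j = coord \<iota> B (c' $ i) $ j" if "j < length B" for j
    using arg_cong[OF eq[OF that], of "\<lambda>v. v $ i"] i c by (simp add: coord_vec_def)
  then have "(\<Sum>j<length B. \<iota> (coord \<iota> B (c $ i) $ j) * B ! j) =
      (\<Sum>j<length B. \<iota> (coord \<iota> B (c' $ i) $ j) * B ! j)" by (intro sum.cong) auto
  then show "c $ i = c' $ i" using coord_expansion[of "c $ i"] coord_expansion[of "c' $ i"] by simp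
qed (use c in simp)

lemma coord_vec_eq_0D:
  assumes c: "c \<in> carrier_vec n" and 0: "\<And>j. j < length B \<Longrightarrow> coord_vec j c = 0\<^sub>v n"
  shows "c = 0\<^sub>v n"
  by (rule coord_vec_inject[OF c]) (use 0 coord_vec_zero in auto)

lemma rows_MB: "rows (MB \<iota> B c) = map (\<lambda>j. coord_vec j c) [0..<length B]"
  by (auto simp: rows_def MB_def coord_vec_def row_def intro!: eq_vecI)

lemma Rsupp_eq: "Rsupp \<iota> B n c = vspan n ((\<lambda>j. coord_vec j c) ` {..<length B})"
  unfolding Rsupp_def rows_MB by (simp add: atLeast0LessThan)

lemma Rsupp_subset_carrier: "c \<in> carrier_vec n \<Longrightarrow> Rsupp \<iota> B n c \<subseteq> carrier_vec n"
  unfolding Rsupp_eq by (rule vspan_minimal[OF vsubspace_carrier]) (auto intro: coord_vec_carrier)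

lemma vsubspace_Rsupp_set: "D \<subseteq> carrier_vec n \<Longrightarrow> vsubspace n (Rsupp_set \<iota> B n D)"
  unfolding Rsupp_set_def using Rsupp_subset_carrier by (intro vsubspace_vspan) blast

lemma coord_vec_in_Rsupp_set:
  assumes D: "D \<subseteq> carrier_vec n" and c: "c \<in> D" and j: "j < length B"
  shows "coord_vec j c \<in> Rsupp_set \<iota> B n D"
proof -
  have "coord_vec j c \<in> Rsupp \<iota> B n c" unfolding Rsupp_eq
    by (rule subsetD[OF vspan_superset]) (use D c j in \<open>auto intro: coord_vec_carrier\<close>)
  moreover have "(\<Union>d\<in>D. Rsupp \<iota> B n d) \<subseteq> Rsupp_set \<iota> B n D" unfolding Rsupp_set_def
    by (rule vspan_superset) (use Rsupp_subset_carrier D in blast)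
  ultimately show ?thesis using c by blast
qed

lemma Rsupp_set_minimal:
  assumes V: "vsubspace n V" and "\<And>c j. c \<in> D \<Longrightarrow> j < length B \<Longrightarrow> coord_vec j c \<in> V"
  shows "Rsupp_set \<iota> B n D \<subseteq> V"
  unfolding Rsupp_set_def Rsupp_eq
  by (intro vspan_minimal[OF V] UN_least) (use assms(2) in auto)

text \<open>Both inclusions use that the support is the least subspace containing all coordinate
  vectors; for the second one, the subspace to test is the preimage under \<open>A\<close> of the
  left-hand side.\<close>

lemma Rsupp_set_image:
  assumes A: "A \<in> carrier_mat p n" and D: "D \<subseteq> carrier_vec n"
  shows "Rsupp_set \<iota> B p ((*\<^sub>v) (ext A) ` D) = (*\<^sub>v) A ` Rsupp_set \<iota> B n D"
proof (rule equalityI)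
  note V = vsubspace_Rsupp_set[OF D]
  show "Rsupp_set \<iota> B p ((*\<^sub>v) (ext A) ` D) \<subseteq> (*\<^sub>v) A ` Rsupp_set \<iota> B n D"
    by (rule Rsupp_set_minimal[OF vsubspace_image[OF V A]])
      (use D in \<open>auto simp: coord_vec_mult[OF A] intro!: imageI coord_vec_in_Rsupp_set[OF D]\<close>)
  have AD: "(*\<^sub>v) (ext A) ` D \<subseteq> carrier_vec p" using A D by auto
  let ?W = "{v \<in> carrier_vec n. A *\<^sub>v v \<in> Rsupp_set \<iota> B p ((*\<^sub>v) (ext A) ` D)}"
  have "Rsupp_set \<iota> B n D \<subseteq> ?W"
  proof (rule Rsupp_set_minimal[OF vsubspace_vimage[OF vsubspace_Rsupp_set[OF AD] A]])
    fix c j assume c: "c \<in> D" and j: "j < length B"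
    then have "c \<in> carrier_vec n" using D by auto
    then show "coord_vec j c \<in> ?W"
      using coord_vec_in_Rsupp_set[OF AD imageI[OF c] j] j
      by (auto simp: coord_vec_mult[OF A] intro: coord_vec_carrier)
  qed
  then show "(*\<^sub>v) A ` Rsupp_set \<iota> B n D \<subseteq> Rsupp_set \<iota> B p ((*\<^sub>v) (ext A) ` D)" by auto
qed

lemma wtR_le_vdim:
  assumes V: "vsubspace n V" and D: "D \<subseteq> carrier_vec n"
    and "\<And>c j. c \<in> D \<Longrightarrow> j < length B \<Longrightarrow> coord_vec j c \<in> V"
  shows "wtR \<iota> B n D \<le> vdim n V"
  unfolding wtR_def using vdim_mono[OF vsubspace_Rsupp_set[OF D] V] Rsupp_set_minimal[OF V] assms(3)
  by simp

lemma wtR_le: "D \<subseteq> carrier_vec n \<Longrightarrow> wtR \<iota> B n D \<le> n"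
  unfolding wtR_def by (rule vdim_le[OF vsubspace_Rsupp_set])

lemma wtR_zero: "wtR \<iota> B n {0\<^sub>v n} = 0"
proof -
  have "wtR \<iota> B n {0\<^sub>v n} \<le> vdim n {0\<^sub>v n :: 'k vec}"
    by (intro wtR_le_vdim vsubspace_zero) (auto simp: coord_vec_zero)
  then show ?thesis using vdim_eq_0_iff[OF vsubspace_zero, where 'a = 'k, of n] by simp
qed

section \<open>Generalized rank weights and their Singleton bound\<close>

lemma Mr_0: "Mr \<iota> B n C 0 = 0"
  by (simp add: Mr_def)

text \<open>There may be infinitely many subcodes, but their weights are bounded by the length; this
  gives \<open>Min\<close> in the definition of \<open>Mr\<close> its meaning.\<close>

lemma finite_wtR_set: "finite {wtR \<iota> B n D | D. vsubspace n D \<and> D \<subseteq> C \<and> vdim n D = r}"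
  by (rule finite_subset[of _ "{..n}"]) (auto intro!: wtR_le dest: vsubspaceD(1))

lemma Mr_le:
  assumes "vsubspace n D" "D \<subseteq> C" "vdim n D = r"
  shows "Mr \<iota> B n C r \<le> wtR \<iota> B n D"
  using assms finite_wtR_set by (auto simp: Mr_def intro!: Min_le)

lemma Mr_attained:
  assumes C: "vsubspace n C" and r: "r \<le> vdim n C"
  obtains D where "vsubspace n D" "D \<subseteq> C" "vdim n D = r" "wtR \<iota> B n D = Mr \<iota> B n C r"
proof (cases "r = 0")
  case True
  \<comment> \<open>The zero subspace has weight 0, in agreement with the convention for
    \<open>r = 0\<close>.\<close>
  show thesis
    by (rule that[OF vsubspace_zero])
      (use True vsubspaceD[OF C] vdim_eq_0_iff[OF vsubspace_zero, where 'a = 'l, of n] in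
        \<open>auto simp: wtR_zero Mr_0\<close>)
next
  case False
  let ?S = "{wtR \<iota> B n D | D. vsubspace n D \<and> D \<subseteq> C \<and> vdim n D = r}"
  have "?S \<noteq> {}" using ex_subspace_of_vdim[OF C r] by blast
  then have "Min ?S \<in> ?S" by (rule Min_in[OF finite_wtR_set])
  then show thesis using that False unfolding Mr_def by auto
qed

lemma Mr_le_length:
  assumes C: "vsubspace n C" and r: "r \<le> vdim n C"
  shows "Mr \<iota> B n C r \<le> n"
proof -
  obtain D where "vsubspace n D" "wtR \<iota> B n D = Mr \<iota> B n C r" using Mr_attained[OF C r] by metis
  then show ?thesis using wtR_le[OF vsubspaceD(1)] by metis
qed

text \<open>An equation over L splits into one equation over K for each element of \<open>B\<close>,
  and injectivity over K settles each of them.\<close>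

lemma ext_injective:
  assumes T: "T \<in> carrier_mat n d"
    and inj: "\<And>y. y \<in> carrier_vec d \<Longrightarrow> T *\<^sub>v y = 0\<^sub>v n \<Longrightarrow> y = 0\<^sub>v d"
    and c: "c \<in> carrier_vec d" and 0: "ext T *\<^sub>v c = 0\<^sub>v n"
  shows "c = 0\<^sub>v d"
proof (rule coord_vec_eq_0D[OF c])
  fix j assume j: "j < length B"
  have "T *\<^sub>v coord_vec j c = 0\<^sub>v n" using coord_vec_mult[OF T c j] 0 coord_vec_zero[OF j] by simp
  then show "coord_vec j c = 0\<^sub>v d" by (intro inj coord_vec_carrier[OF c])
qed

lemma wtR_ext_image:
  assumes T: "T \<in> carrier_mat n d"
    and inj: "\<And>y. y \<in> carrier_vec d \<Longrightarrow> T *\<^sub>v y = 0\<^sub>v n \<Longrightarrow> y = 0\<^sub>v d"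
    and D: "D \<subseteq> carrier_vec d"
  shows "wtR \<iota> B n ((*\<^sub>v) (ext T) ` D) = wtR \<iota> B d D"
  unfolding wtR_def Rsupp_set_image[OF T D]
  by (rule vdim_image_inj[OF vsubspace_Rsupp_set[OF D] T])
    (use inj vsubspaceD(5)[OF vsubspace_Rsupp_set[OF D]] in blast)

lemma vdim_vimage_ext:
  assumes T: "T \<in> carrier_mat n d"
    and inj: "\<And>y. y \<in> carrier_vec d \<Longrightarrow> T *\<^sub>v y = 0\<^sub>v n \<Longrightarrow> y = 0\<^sub>v d"
    and D: "vsubspace n D" and im: "D \<subseteq> (*\<^sub>v) (ext T) ` carrier_vec d"
  shows "(*\<^sub>v) (ext T) ` {c \<in> carrier_vec d. ext T *\<^sub>v c \<in> D} = D"
    and "vdim d {c \<in> carrier_vec d. ext T *\<^sub>v c \<in> D} = vdim n D"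
    and "wtR \<iota> B d {c \<in> carrier_vec d. ext T *\<^sub>v c \<in> D} = wtR \<iota> B n D"
proof -
  have eT: "ext T \<in> carrier_mat n d" using T by simp
  let ?D = "{c \<in> carrier_vec d. ext T *\<^sub>v c \<in> D}"
  show eq: "(*\<^sub>v) (ext T) ` ?D = D" using im by auto
  show "vdim d ?D = vdim n D"
    using vdim_image_inj[OF vsubspace_vimage[OF D eT] eT] ext_injective[OF T inj] eq by auto
  have sub: "?D \<subseteq> carrier_vec d" by auto
  show "wtR \<iota> B d ?D = wtR \<iota> B n D" using wtR_ext_image[OF T inj sub] by (simp add: eq)
qed

text \<open>Preimages over K of the coordinate vectors are themselves the coordinate vectors of a
  preimage over L: it is assembled from them with the basis \<open>B\<close>.\<close>

lemma in_ext_image: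
  assumes T: "T \<in> carrier_mat n d" and c: "c \<in> carrier_vec n"
    and im: "\<And>j. j < length B \<Longrightarrow> coord_vec j c \<in> (*\<^sub>v) T ` carrier_vec d"
  shows "c \<in> (*\<^sub>v) (ext T) ` carrier_vec d"
proof -
  have "\<forall>j. \<exists>y. j < length B \<longrightarrow> y \<in> carrier_vec d \<and> coord_vec j c = T *\<^sub>v y"
    using im by blast
  then obtain y where y: "\<And>j. j < length B \<Longrightarrow> y j \<in> carrier_vec d \<and> coord_vec j c = T *\<^sub>v y j"
    by metis
  define x where "x = vec d (\<lambda>i. \<Sum>j<length B. \<iota> (y j $ i) * B ! j)"
  have x: "x \<in> carrier_vec d" by (simp add: x_def)
  have "coord \<iota> B (x $ i) = vec (length B) (\<lambda>j. y j $ i)" if "i < d" for i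
    by (rule coord_unique) (use that in \<open>auto simp: x_def\<close>)
  then have xy: "coord_vec j x = y j" if "j < length B" for j
    using y[OF that] x that by (auto simp: coord_vec_def intro!: eq_vecI)
  have "c = ext T *\<^sub>v x"
  proof (rule coord_vec_inject[OF c])
    show "ext T *\<^sub>v x \<in> carrier_vec n" using T x by simp
    show "coord_vec j c = coord_vec j (ext T *\<^sub>v x)" if "j < length B" for j
      using coord_vec_mult[OF T x that] xy[OF that] y[OF that] by simp
  qed
  then show ?thesis using x by blast
qed

text \<open>Multiplication by \<open>ext T\<close> matches the subcodes on the two sides. It
  preserves their dimension, and also their weight, because the injective matrix \<open>T\<close>
  maps supports isomorphically. Both minima therefore run over the same set of numbers.\<close>

lemma Mr_vimage_ext:
  assumes T: "T \<in> carrier_mat n d"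
    and inj: "\<And>y. y \<in> carrier_vec d \<Longrightarrow> T *\<^sub>v y = 0\<^sub>v n \<Longrightarrow> y = 0\<^sub>v d"
    and C: "vsubspace n C" and im: "C \<subseteq> (*\<^sub>v) (ext T) ` carrier_vec d"
  shows "Mr \<iota> B d {c \<in> carrier_vec d. ext T *\<^sub>v c \<in> C} r = Mr \<iota> B n C r"
proof -
  have eT: "ext T \<in> carrier_mat n d" using T by simp
  let ?v = "\<lambda>D. {c \<in> carrier_vec d. ext T *\<^sub>v c \<in> D}"
  let ?S = "\<lambda>D. vsubspace d D \<and> D \<subseteq> ?v C \<and> vdim d D = r"
  let ?S' = "\<lambda>D. vsubspace n D \<and> D \<subseteq> C \<and> vdim n D = r"
  have 1: "\<exists>D'. ?S' D' \<and> wtR \<iota> B n D' = wtR \<iota> B d D" if D: "?S D" for D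
  proof (intro exI conjI)
    let ?D' = "(*\<^sub>v) (ext T) ` D"
    have sD: "vsubspace d D" and DC: "D \<subseteq> ?v C" using D by auto
    note D' = vsubspaceD[OF sD]
    show sD': "vsubspace n ?D'" by (rule vsubspace_image[OF sD eT])
    show "?D' \<subseteq> C" using DC by auto
    show "vdim n ?D' = r"
      using vdim_image_inj[OF sD eT] ext_injective[OF T inj] D D'(5) by auto
    show "wtR \<iota> B n ?D' = wtR \<iota> B d D" by (rule wtR_ext_image[OF T inj D'(1)])
  qed
  have 2: "\<exists>D. ?S D \<and> wtR \<iota> B d D = wtR \<iota> B n D'" if D': "?S' D'" for D'
  proof (intro exI conjI)
    have s: "vsubspace n D'" and i: "D' \<subseteq> (*\<^sub>v) (ext T) ` carrier_vec d" using D' im by auto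
    show "vsubspace d (?v D')" by (rule vsubspace_vimage[OF s eT])
    show "?v D' \<subseteq> ?v C" using D' by auto
    show "vdim d (?v D') = r" using vdim_vimage_ext(2)[OF T inj s i] D' by simp
    show "wtR \<iota> B d (?v D') = wtR \<iota> B n D'" by (rule vdim_vimage_ext(3)[OF T inj s i])
  qed
  have "{wtR \<iota> B d D | D. ?S D} = {wtR \<iota> B n D | D. ?S' D}"
  proof (intro equalityI subsetI)
    fix w assume "w \<in> {wtR \<iota> B d D | D. ?S D}"
    then obtain D where "?S D" "w = wtR \<iota> B d D" by blast
    moreover from 1[OF this(1)] obtain D' where "?S' D'" "wtR \<iota> B n D' = wtR \<iota> B d D" by blast
    ultimately show "w \<in> {wtR \<iota> B n D | D. ?S' D}" by (auto intro!: exI[of _ D'])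
  next
    fix w assume "w \<in> {wtR \<iota> B n D | D. ?S' D}"
    then obtain D where "?S' D" "w = wtR \<iota> B n D" by blast
    moreover from 2[OF this(1)] obtain D' where "?S D'" "wtR \<iota> B d D' = wtR \<iota> B n D" by blast
    ultimately show "w \<in> {wtR \<iota> B d D | D. ?S D}" by (auto intro!: exI[of _ D'])
  qed
  then show ?thesis unfolding Mr_def by simp
qed

text \<open>Requiring the last \<open>vdim n C - r\<close> coordinates to vanish leaves a subcode of
  dimension at least \<open>r\<close>, whose support lives on the first \<open>j\<close>
  coordinates. The form as a sum avoids truncated subtraction.\<close>

lemma Mr_singleton_bound:
  assumes C: "vsubspace n C" and r: "r \<le> vdim n C"
  shows "Mr \<iota> B n C r + vdim n C \<le> n + r"
proof -
  define j where "j = n - (vdim n C - r)"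
  let ?D = "{v \<in> C. \<forall>i\<in>{j..<n}. v $ i = 0}"
  have k: "vdim n C \<le> n" by (rule vdim_le[OF C])
  have "?D = C \<inter> {v \<in> carrier_vec n. \<forall>i\<in>{j..<n}. v $ i = 0}" using vsubspaceD(1)[OF C] by auto
  moreover have "vsubspace n {v \<in> carrier_vec n. \<forall>i\<in>{j..<n}. v $ i = (0 :: 'l)}"
    by (rule vsubspaceI) auto
  ultimately have D: "vsubspace n ?D" using vsubspace_Int[OF C] by simp
  have "r \<le> vdim n ?D" using vdim_drop_coords[OF C, of j] k r by (simp add: j_def)
  then obtain D' where D': "vsubspace n D'" "D' \<subseteq> ?D" "vdim n D' = r" by (rule ex_subspace_of_vdim[OF D])
  have "wtR \<iota> B n D' \<le> vdim n {v \<in> carrier_vec n. \<forall>i\<in>{j..<n}. v $ i = (0 :: 'k)}"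
  proof (rule wtR_le_vdim)
    show "vsubspace n {v \<in> carrier_vec n. \<forall>i\<in>{j..<n}. v $ i = (0 :: 'k)}" by (rule vsubspaceI) auto
    show "D' \<subseteq> carrier_vec n" by (rule vsubspaceD(1)[OF D'(1)])
    fix c l assume c: "c \<in> D'" and l: "l < length B"
    have "c \<in> carrier_vec n" "\<forall>i\<in>{j..<n}. c $ i = 0" using c D' vsubspaceD(5)[OF D'(1)] by auto
    then show "coord_vec l c \<in> {v \<in> carrier_vec n. \<forall>i\<in>{j..<n}. v $ i = (0 :: 'k)}"
      using l by (auto simp: coord_vec_def coord_0)
  qed
  also have "\<dots> \<le> j" by (rule vdim_coords_zero_le)
  finally have "wtR \<iota> B n D' \<le> j" .
  moreover have "D' \<subseteq> C" using D'(2) by blast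
  ultimately have "Mr \<iota> B n C r \<le> j" using Mr_le[OF D'(1) _ D'(3), of C] by simp
  then show ?thesis using k r by (simp add: j_def)
qed

end

subsection \<open>Codes stable under orthogonal idempotents\<close>

text \<open>The subspaces \<open>?F j\<close> increase from the zero space, by
  \<open>separating\<close>, up to \<open>V\<close>, and \<open>?F j\<close> is the kernel of
  \<open>E (Suc j)\<close> on \<open>?F (Suc j)\<close>. Rank-nullity telescopes along this
  filtration.\<close>

lemma vdim_eq_sum_graded_pieces:
  fixes E :: "nat \<Rightarrow> 'a :: field mat"
  assumes E: "\<And>j. j \<in> {1..s} \<Longrightarrow> E j \<in> carrier_mat n n"
    and separating: "\<And>v. v \<in> carrier_vec n \<Longrightarrow> (\<And>j. j \<in> {1..s} \<Longrightarrow> E j *\<^sub>v v = 0\<^sub>v n) \<Longrightarrow> v = 0\<^sub>v n"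
    and V: "vsubspace n V"
  shows "vdim n V = (\<Sum>j\<in>{1..s}. vdim n ((*\<^sub>v) (E j) ` {v \<in> V. \<forall>l\<in>{j<..s}. E l *\<^sub>v v = 0\<^sub>v n}))"
proof -
  let ?F = "\<lambda>j. {v \<in> V. \<forall>l\<in>{j<..s}. E l *\<^sub>v v = 0\<^sub>v n}"
  note V' = vsubspaceD[OF V]
  have F: "vsubspace n (?F j)" for j
    by (rule vsubspace_common_kernel[OF V]) (use E in auto)
  have "vdim n (?F j) = (\<Sum>l\<in>{1..j}. vdim n ((*\<^sub>v) (E l) ` ?F l))" if "j \<le> s" for j
    using that
  proof (induction j)
    case 0
    have "v = 0\<^sub>v n" if "v \<in> ?F 0" for v
      by (rule separating) (use that V' in auto)
    then have "?F 0 = {0\<^sub>v n}" using vsubspaceD(2)[OF F[of 0]] by blast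
    then show ?case using vdim_eq_0_iff[OF F[of 0]] by simp
  next
    case (Suc j)
    have j: "Suc j \<in> {1..s}" using Suc.prems by simp
    have "{j<..s} = insert (Suc j) {Suc j<..s}" using Suc.prems by auto
    then have "?F (Suc j) \<inter> mat_kernel (E (Suc j)) = ?F j"
      using V' E[OF j] by (auto simp: mat_kernel_def)
    then show ?case using vdim_rank_nullity[OF F E[OF j], of "Suc j"] Suc by simp
  qed
  from this[of s] show ?thesis by simp
qed

text \<open>\<open>E_separating\<close> stands for the idempotents adding up to the identity: by
  \<open>E_orth\<close> and \<open>E_idem\<close> every \<open>E i\<close> annihilates the
  difference of \<open>v\<close> and the sum of its projections. In this form the condition passes
  to L coordinate by coordinate and starts the filtration at the zero space.\<close>

locale decomposed_code = ordered_field_extension \<iota> B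
  for \<iota> :: "'k :: field \<Rightarrow> 'l :: field" and B :: "'l list" +
  fixes n s :: nat and E :: "nat \<Rightarrow> 'k mat" and C :: "'l vec set"
  assumes E_carrier: "\<And>j. j \<in> {1..s} \<Longrightarrow> E j \<in> carrier_mat n n"
    and E_orth: "\<And>i j. i \<in> {1..s} \<Longrightarrow> j \<in> {1..s} \<Longrightarrow> i \<noteq> j \<Longrightarrow> E i * E j = 0\<^sub>m n n"
    and E_separating:
      "\<And>v. v \<in> carrier_vec n \<Longrightarrow> (\<And>j. j \<in> {1..s} \<Longrightarrow> E j *\<^sub>v v = 0\<^sub>v n) \<Longrightarrow> v = 0\<^sub>v n"
    and E_idem: "\<And>j. j \<in> {1..s} \<Longrightarrow> E j * E j = E j"
    and C: "vsubspace n C"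
    and E_C: "\<And>j c. j \<in> {1..s} \<Longrightarrow> c \<in> C \<Longrightarrow> ext (E j) *\<^sub>v c \<in> C"
begin

interpretation \<iota>: field_hom \<iota> by (rule hom)

text \<open>The image of \<open>C\<close> under the idempotent \<open>E j\<close>, written as its
  set of fixed points. For the primary idempotents it becomes the intersection of \<open>C\<close>
  with the kernel of the \<open>j\<close>-th prime power at \<open>M\<close>.\<close>

definition component :: "nat \<Rightarrow> 'l vec set" where
  "component j = {c \<in> C. ext (E j) *\<^sub>v c = c}"

lemma C_carrier: "c \<in> C \<Longrightarrow> c \<in> carrier_vec n"
  using vsubspaceD(5)[OF C] .

lemma extE_carrier: "j \<in> {1..s} \<Longrightarrow> ext (E j) \<in> carrier_mat n n"
  using E_carrier by simp

lemma extE_separating: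
  assumes v: "v \<in> carrier_vec n" and 0: "\<And>j. j \<in> {1..s} \<Longrightarrow> ext (E j) *\<^sub>v v = 0\<^sub>v n"
  shows "v = 0\<^sub>v n"
proof (rule coord_vec_eq_0D[OF v])
  fix l assume l: "l < length B"
  show "coord_vec l v = 0\<^sub>v n"
  proof (rule E_separating)
    fix j assume j: "j \<in> {1..s}"
    show "E j *\<^sub>v coord_vec l v = 0\<^sub>v n"
      using coord_vec_mult[OF E_carrier[OF j] v l] 0[OF j] coord_vec_zero[OF l] by simp
  qed (rule coord_vec_carrier[OF v])
qed

lemma extE_idem:
  assumes j: "j \<in> {1..s}" and v: "v \<in> carrier_vec n"
  shows "ext (E j) *\<^sub>v (ext (E j) *\<^sub>v v) = ext (E j) *\<^sub>v v"
proof -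
  have "ext (E j) * ext (E j) = ext (E j)"
    using \<iota>.mat_hom_mult[OF E_carrier[OF j] E_carrier[OF j]] E_idem[OF j] by simp
  then show ?thesis using assoc_mult_mat_vec[OF extE_carrier[OF j] extE_carrier[OF j] v] by simp
qed

lemma extE_orth:
  assumes ij: "i \<in> {1..s}" "j \<in> {1..s}" "i \<noteq> j" and v: "v \<in> carrier_vec n"
  shows "ext (E i) *\<^sub>v (ext (E j) *\<^sub>v v) = 0\<^sub>v n"
proof -
  have "ext (E i) * ext (E j) = ext (0\<^sub>m n n)"
    using \<iota>.mat_hom_mult[OF E_carrier[OF ij(1)] E_carrier[OF ij(2)]] E_orth[OF ij] by simp
  also have "\<dots> = 0\<^sub>m n n" by (auto intro!: eq_matI)
  finally have "ext (E i) *\<^sub>v (ext (E j) *\<^sub>v v) = 0\<^sub>m n n *\<^sub>v v"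
    using assoc_mult_mat_vec[OF extE_carrier[OF ij(1)] extE_carrier[OF ij(2)] v] by simp
  also have "\<dots> = 0\<^sub>v n" using v by (rule zero_mult_mat_vec)
  finally show ?thesis .
qed

lemma component_subset: "component j \<subseteq> C"
  by (auto simp: component_def)

lemma vsubspace_component:
  assumes j: "j \<in> {1..s}"
  shows "vsubspace n (component j)"
  unfolding component_def using vsubspaceD[OF C] extE_carrier[OF j]
  by (intro vsubspaceI) (auto simp: mult_add_distrib_mat_vec[of _ n n] mult_mat_vec[of _ n n])

lemma extE_in_component: "j \<in> {1..s} \<Longrightarrow> c \<in> C \<Longrightarrow> ext (E j) *\<^sub>v c \<in> component j"
  by (simp add: component_def E_C extE_idem C_carrier)

lemma extE_component_other:
  assumes "i \<in> {1..s}" "j \<in> {1..s}" "i \<noteq> j" "c \<in> component j"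
  shows "ext (E i) *\<^sub>v c = 0\<^sub>v n"
  using extE_orth[OF assms(1-3), of c] assms(4) C_carrier by (auto simp: component_def)

text \<open>\<open>S\<close> is the direct sum of the \<open>D j\<close>, described by conditions on
  the projections so that it is a common preimage. The analogous space over K contains the support
  of \<open>S\<close>, and the filtration computes the dimensions of both.\<close>

lemma sum_subspaces:
  assumes Dj: "\<And>j. j \<in> {1..s} \<Longrightarrow> vsubspace n (D j) \<and> D j \<subseteq> component j"
  defines "S \<equiv> {c \<in> C. \<forall>j\<in>{1..s}. ext (E j) *\<^sub>v c \<in> D j}"
  shows "vsubspace n S" and "vdim n S = (\<Sum>j\<in>{1..s}. vdim n (D j))"
    and "wtR \<iota> B n S \<le> (\<Sum>j\<in>{1..s}. wtR \<iota> B n (D j))"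
proof -
  have Dsub: "vsubspace n (D j)" if "j \<in> {1..s}" for j using Dj that by blast
  have Dc: "D j \<subseteq> carrier_vec n" if "j \<in> {1..s}" for j using vsubspaceD(1)[OF Dsub[OF that]] .
  show S: "vsubspace n S"
    unfolding S_def by (rule vsubspace_common_vimage[OF C extE_carrier Dsub])
  have DS: "D j \<subseteq> S" if j: "j \<in> {1..s}" for j
  proof
    fix c assume c: "c \<in> D j"
    then have cc: "c \<in> component j" using Dj[OF j] by auto
    have "ext (E i) *\<^sub>v c \<in> D i" if i: "i \<in> {1..s}" for i
    proof (cases "i = j")
      case True
      then show ?thesis using cc c by (simp add: component_def)
    next
      case False
      then show ?thesis using extE_component_other[OF i j False cc] vsubspaceD(2)[OF Dsub[OF i]] by simp
    qed
    then show "c \<in> S" using cc component_subset by (auto simp: S_def)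
  qed
  \<comment> \<open>\<open>D j\<close> lies in step \<open>j\<close> of the filtration, because the
    other projections vanish on it, and \<open>ext (E j)\<close> fixes it; so the graded pieces of
    \<open>S\<close> are the given subspaces.\<close>
  have "(*\<^sub>v) (ext (E j)) ` {c \<in> S. \<forall>l\<in>{j<..s}. ext (E l) *\<^sub>v c = 0\<^sub>v n} = D j" if j: "j \<in> {1..s}" for j
  proof (intro equalityI subsetI)
    fix c assume c: "c \<in> D j"
    then have cc: "c \<in> component j" using Dj[OF j] by auto
    have "ext (E l) *\<^sub>v c = 0\<^sub>v n" if "l \<in> {j<..s}" for l
      by (rule extE_component_other[OF _ j _ cc]) (use that j in auto)
    then show "c \<in> (*\<^sub>v) (ext (E j)) ` {c \<in> S. \<forall>l\<in>{j<..s}. ext (E l) *\<^sub>v c = 0\<^sub>v n}"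
      using cc DS[OF j] c by (intro image_eqI[of _ _ c]) (auto simp: component_def)
  qed (use j in \<open>auto simp: S_def\<close>)
  then show "vdim n S = (\<Sum>j\<in>{1..s}. vdim n (D j))"
    by (subst vdim_eq_sum_graded_pieces[OF extE_carrier extE_separating S])
      (auto intro!: sum.cong)
  let ?R = "\<lambda>j. Rsupp_set \<iota> B n (D j)"
  have R: "vsubspace n (?R j)" if "j \<in> {1..s}" for j by (rule vsubspace_Rsupp_set[OF Dc[OF that]])
  \<comment> \<open>The counterpart of \<open>S\<close> over K. Its graded pieces lie in the
    supports of the \<open>D j\<close>, whence subadditivity of the weight.\<close>
  let ?V = "{v \<in> carrier_vec n. \<forall>j\<in>{1..s}. E j *\<^sub>v v \<in> ?R j}"
  have V: "vsubspace n ?V"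
    by (rule vsubspace_common_vimage[OF vsubspace_carrier E_carrier R])
  have "wtR \<iota> B n S \<le> vdim n ?V"
  proof (rule wtR_le_vdim[OF V vsubspaceD(1)[OF S]])
    fix c l assume c: "c \<in> S" and l: "l < length B"
    have cc: "c \<in> carrier_vec n" using vsubspaceD(5)[OF S c] .
    have "E j *\<^sub>v coord_vec l c \<in> ?R j" if j: "j \<in> {1..s}" for j
      unfolding coord_vec_mult[OF E_carrier[OF j] cc l, symmetric]
      by (rule coord_vec_in_Rsupp_set[OF Dc[OF j] _ l]) (use c j in \<open>auto simp: S_def\<close>)
    then show "coord_vec l c \<in> ?V" using coord_vec_carrier[OF cc] by auto
  qed
  also have "\<dots> = (\<Sum>j\<in>{1..s}. vdim n ((*\<^sub>v) (E j) ` {v \<in> ?V. \<forall>l\<in>{j<..s}. E l *\<^sub>v v = 0\<^sub>v n}))"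
    by (rule vdim_eq_sum_graded_pieces[OF E_carrier E_separating V])
  also have "\<dots> \<le> (\<Sum>j\<in>{1..s}. wtR \<iota> B n (D j))"
  proof (rule sum_mono)
    fix j assume j: "j \<in> {1..s}"
    let ?F = "{v \<in> ?V. \<forall>l\<in>{j<..s}. E l *\<^sub>v v = 0\<^sub>v n}"
    have F: "vsubspace n ?F"
      by (rule vsubspace_common_kernel[OF V]) (use E_carrier in auto)
    show "vdim n ((*\<^sub>v) (E j) ` ?F) \<le> wtR \<iota> B n (D j)" unfolding wtR_def
      by (rule vdim_mono[OF vsubspace_image[OF F E_carrier[OF j]] R[OF j]]) (use j in auto)
  qed
  finally show "wtR \<iota> B n S \<le> (\<Sum>j\<in>{1..s}. wtR \<iota> B n (D j))" .
qed

lemma vdim_C: "vdim n C = (\<Sum>j\<in>{1..s}. vdim n (component j))"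
proof -
  have "{c \<in> C. \<forall>j\<in>{1..s}. ext (E j) *\<^sub>v c \<in> component j} = C" using extE_in_component by auto
  then show ?thesis using sum_subspaces(2)[of component] vsubspace_component by simp
qed

lemma Mr_C_le:
  assumes rr: "\<And>j. j \<in> {1..s} \<Longrightarrow> rr j \<le> vdim n (component j)"
  shows "Mr \<iota> B n C (\<Sum>j\<in>{1..s}. rr j) \<le> (\<Sum>j\<in>{1..s}. Mr \<iota> B n (component j) (rr j))"
proof -
  have "\<forall>j. \<exists>D. j \<in> {1..s} \<longrightarrow> vsubspace n D \<and> D \<subseteq> component j \<and> vdim n D = rr j \<and>
      wtR \<iota> B n D = Mr \<iota> B n (component j) (rr j)"
    using Mr_attained[OF vsubspace_component rr] by metis
  then obtain D where D: "\<And>j. j \<in> {1..s} \<Longrightarrow> vsubspace n (D j) \<and> D j \<subseteq> component j \<and>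
      vdim n (D j) = rr j \<and> wtR \<iota> B n (D j) = Mr \<iota> B n (component j) (rr j)" by metis
  then have D': "\<And>j. j \<in> {1..s} \<Longrightarrow> vsubspace n (D j) \<and> D j \<subseteq> component j" by blast
  let ?S = "{c \<in> C. \<forall>j\<in>{1..s}. ext (E j) *\<^sub>v c \<in> D j}"
  have "Mr \<iota> B n C (\<Sum>j\<in>{1..s}. rr j) \<le> wtR \<iota> B n ?S"
    by (rule Mr_le[OF sum_subspaces(1)[OF D']]) (use sum_subspaces(2)[OF D'] D in auto)
  also have "\<dots> \<le> (\<Sum>j\<in>{1..s}. wtR \<iota> B n (D j))" by (rule sum_subspaces(3)[OF D'])
  finally show ?thesis using D by simp
qed

text \<open>The witness \<open>rr j\<close> is the dimension of the graded piece of \<open>D\<close>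
  in component \<open>j\<close>; it depends on the numbering of the idempotents, but any admissible
  splitting of the dimension serves for the minimum.\<close>

lemma ex_Mr_sum_le_wtR:
  assumes D: "vsubspace n D" and DC: "D \<subseteq> C"
  obtains rr where "\<And>j. j \<in> {1..s} \<Longrightarrow> rr j \<le> vdim n (component j)" "(\<Sum>j\<in>{1..s}. rr j) = vdim n D"
    "(\<Sum>j\<in>{1..s}. Mr \<iota> B n (component j) (rr j)) \<le> wtR \<iota> B n D"
proof -
  have Dc: "D \<subseteq> carrier_vec n" by (rule vsubspaceD(1)[OF D])
  let ?V = "Rsupp_set \<iota> B n D"
  have V: "vsubspace n ?V" by (rule vsubspace_Rsupp_set[OF Dc])
  let ?F = "\<lambda>j. {v \<in> ?V. \<forall>l\<in>{j<..s}. E l *\<^sub>v v = 0\<^sub>v n}"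
  let ?G = "\<lambda>j. {c \<in> D. \<forall>l\<in>{j<..s}. ext (E l) *\<^sub>v c = 0\<^sub>v n}"
  have F: "vsubspace n (?F j)" if "j \<in> {1..s}" for j
    by (rule vsubspace_common_kernel[OF V]) (use E_carrier in auto)
  have G: "vsubspace n (?G j)" if "j \<in> {1..s}" for j
    by (rule vsubspace_common_kernel[OF D]) (use E_carrier in auto)
  let ?D = "\<lambda>j. (*\<^sub>v) (ext (E j)) ` ?G j"
  have Dj: "vsubspace n (?D j)" if "j \<in> {1..s}" for j
    by (rule vsubspace_image[OF G[OF that] extE_carrier[OF that]])
  have Dcomp: "?D j \<subseteq> component j" if "j \<in> {1..s}" for j using extE_in_component[OF that] DC by auto
  show thesis
  proof (rule that[of "\<lambda>j. vdim n (?D j)"])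
    show "vdim n (?D j) \<le> vdim n (component j)" if "j \<in> {1..s}" for j
      by (rule vdim_mono[OF Dj[OF that] vsubspace_component[OF that] Dcomp[OF that]])
    show "(\<Sum>j\<in>{1..s}. vdim n (?D j)) = vdim n D"
      by (rule vdim_eq_sum_graded_pieces[OF extE_carrier extE_separating D, symmetric])
    have "(\<Sum>j\<in>{1..s}. Mr \<iota> B n (component j) (vdim n (?D j))) \<le> (\<Sum>j\<in>{1..s}. vdim n ((*\<^sub>v) (E j) ` ?F j))"
    proof (rule sum_mono)
      fix j assume j: "j \<in> {1..s}"
      have "Mr \<iota> B n (component j) (vdim n (?D j)) \<le> wtR \<iota> B n (?D j)"
        by (rule Mr_le[OF Dj[OF j] Dcomp[OF j] refl])
      also have "\<dots> \<le> vdim n ((*\<^sub>v) (E j) ` ?F j)"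
      proof (rule wtR_le_vdim[OF vsubspace_image[OF F[OF j] E_carrier[OF j]] vsubspaceD(1)[OF Dj[OF j]]])
        fix c i assume "c \<in> ?D j" and i: "i < length B"
        then obtain x where x: "x \<in> ?G j" "c = ext (E j) *\<^sub>v x" by blast
        have xc: "x \<in> carrier_vec n" and xD: "x \<in> D" using x Dc by auto
        \<comment> \<open>Here the two filtrations meet: the vanishing of \<open>ext (E l)\<close>
          on \<open>x\<close> is inherited by each coordinate vector of \<open>x\<close>, which
          therefore lies in step \<open>j\<close> of the filtration of the support.\<close>
        have "E l *\<^sub>v coord_vec i x = 0\<^sub>v n" if l: "l \<in> {j<..s}" for l
        proof -
          have l': "l \<in> {1..s}" using l by auto
          show ?thesis
            using coord_vec_mult[OF E_carrier[OF l'] xc i] x(1) l coord_vec_zero[OF i] by simp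
        qed
        then have "coord_vec i x \<in> ?F j" using coord_vec_in_Rsupp_set[OF Dc xD i] by simp
        then show "coord_vec i c \<in> (*\<^sub>v) (E j) ` ?F j"
          unfolding x(2) coord_vec_mult[OF E_carrier[OF j] xc i] by (rule imageI)
      qed
      finally show "Mr \<iota> B n (component j) (vdim n (?D j)) \<le> vdim n ((*\<^sub>v) (E j) ` ?F j)" .
    qed
    also have "\<dots> = wtR \<iota> B n D" unfolding wtR_def
      by (rule vdim_eq_sum_graded_pieces[OF E_carrier E_separating V, symmetric])
    finally show "(\<Sum>j\<in>{1..s}. Mr \<iota> B n (component j) (vdim n (?D j))) \<le> wtR \<iota> B n D" .
  qed
qed

definition \<Lambda> :: "nat set" where "\<Lambda> = {i \<in> {1..s}. component i \<noteq> {0\<^sub>v n}}"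

lemma \<Lambda>_subset: "\<Lambda> \<subseteq> {1..s}" and finite_\<Lambda>: "finite \<Lambda>"
  by (auto simp: \<Lambda>_def)

lemma vdim_component_not_\<Lambda>: "i \<in> {1..s} \<Longrightarrow> i \<notin> \<Lambda> \<Longrightarrow> vdim n (component i) = 0"
  using vdim_eq_0_iff[OF vsubspace_component, of i] by (simp add: \<Lambda>_def)

lemma vdim_component_\<Lambda>: "i \<in> \<Lambda> \<Longrightarrow> vdim n (component i) \<ge> 1"
  using vdim_eq_0_iff[OF vsubspace_component, of i] by (simp add: \<Lambda>_def Suc_le_eq)

lemma vdim_C_\<Lambda>: "vdim n C = (\<Sum>i\<in>\<Lambda>. vdim n (component i))"
  unfolding vdim_C using \<Lambda>_subset vdim_component_not_\<Lambda> by (intro sum.mono_neutral_right) auto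

lemma Mr_C_le_\<Lambda>:
  assumes rr: "\<And>j. j \<in> \<Lambda> \<Longrightarrow> rr j \<le> vdim n (component j)"
  shows "Mr \<iota> B n C (\<Sum>j\<in>\<Lambda>. rr j) \<le> (\<Sum>j\<in>\<Lambda>. Mr \<iota> B n (component j) (rr j))"
proof -
  \<comment> \<open>Extension by zero outside \<open>\<Lambda>\<close>; both sums are unchanged
    since \<open>Mr\<close> is 0 at 0.\<close>
  let ?r = "\<lambda>j. if j \<in> \<Lambda> then rr j else 0"
  have "(\<Sum>j\<in>{1..s}. ?r j) = (\<Sum>j\<in>\<Lambda>. rr j)"
    using \<Lambda>_subset by (intro sum.mono_neutral_cong_right) auto
  moreover have "(\<Sum>j\<in>{1..s}. Mr \<iota> B n (component j) (?r j)) = (\<Sum>j\<in>\<Lambda>. Mr \<iota> B n (component j) (rr j))"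
    using \<Lambda>_subset by (intro sum.mono_neutral_cong_right) (auto simp: Mr_0)
  ultimately show ?thesis using Mr_C_le[of ?r] rr by auto
qed

lemma ex_Mr_C_eq:
  assumes r: "r \<le> vdim n C"
  shows "\<exists>rr. (\<forall>i\<in>\<Lambda>. rr i \<le> vdim n (component i)) \<and> (\<Sum>i\<in>\<Lambda>. rr i) = r \<and>
    Mr \<iota> B n C r = (\<Sum>i\<in>\<Lambda>. Mr \<iota> B n (component i) (rr i))"
proof -
  obtain D where D: "vsubspace n D" "D \<subseteq> C" "vdim n D = r" "wtR \<iota> B n D = Mr \<iota> B n C r"
    by (rule Mr_attained[OF C r])
  obtain rr where rr: "\<And>j. j \<in> {1..s} \<Longrightarrow> rr j \<le> vdim n (component j)" "(\<Sum>j\<in>{1..s}. rr j) = vdim n D"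
    "(\<Sum>j\<in>{1..s}. Mr \<iota> B n (component j) (rr j)) \<le> wtR \<iota> B n D" by (rule ex_Mr_sum_le_wtR[OF D(1,2)]) blast
  have le: "\<forall>i\<in>\<Lambda>. rr i \<le> vdim n (component i)" using rr(1) \<Lambda>_subset by blast
  \<comment> \<open>Outside \<open>\<Lambda>\<close> the component is the zero space, which forces
    \<open>rr j = 0\<close>.\<close>
  have z: "rr j = 0" if "j \<in> {1..s} - \<Lambda>" for j using rr(1) vdim_component_not_\<Lambda> that by force
  have "(\<Sum>j\<in>{1..s}. rr j) = (\<Sum>j\<in>\<Lambda>. rr j)"
    using \<Lambda>_subset z by (intro sum.mono_neutral_right) auto
  then have sum: "(\<Sum>j\<in>\<Lambda>. rr j) = r" using rr(2) D(3) by simp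
  have "(\<Sum>j\<in>{1..s}. Mr \<iota> B n (component j) (rr j)) = (\<Sum>j\<in>\<Lambda>. Mr \<iota> B n (component j) (rr j))"
    using \<Lambda>_subset z by (intro sum.mono_neutral_right) (auto simp: Mr_0)
  then have "(\<Sum>j\<in>\<Lambda>. Mr \<iota> B n (component j) (rr j)) \<le> Mr \<iota> B n C r" using rr(3) D(4) by simp
  moreover have "Mr \<iota> B n C r \<le> (\<Sum>j\<in>\<Lambda>. Mr \<iota> B n (component j) (rr j))"
    using Mr_C_le_\<Lambda>[of rr] le sum by auto
  ultimately have "Mr \<iota> B n C r = (\<Sum>j\<in>\<Lambda>. Mr \<iota> B n (component j) (rr j))" by simp
  then show ?thesis using le sum by blast
qed

lemma Mr_C_eq_Min:
  assumes r: "r \<le> vdim n C"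
  shows "Mr \<iota> B n C r = Min {\<Sum>i\<in>\<Lambda>. Mr \<iota> B n (component i) (rr i) | rr.
    (\<forall>i\<in>\<Lambda>. rr i \<le> vdim n (component i)) \<and> (\<Sum>i\<in>\<Lambda>. rr i) = r}" (is "_ = Min ?S")
proof (rule Min_eqI[symmetric])
  \<comment> \<open>The values of \<open>rr\<close> outside \<open>\<Lambda>\<close> are free, so
    infinitely many functions qualify; finiteness comes from bounding the values of the sum.\<close>
  have "w \<le> (\<Sum>i\<in>\<Lambda>. n)" if "w \<in> ?S" for w
    using that \<Lambda>_subset by (auto intro!: sum_mono Mr_le_length vsubspace_component simp del: sum_constant)
  then show "finite ?S" by (intro finite_subset[of ?S "{..\<Sum>i\<in>\<Lambda>. n}"]) auto
  show "Mr \<iota> B n C r \<le> w" if "w \<in> ?S" for w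
    using that Mr_C_le_\<Lambda> by fastforce
  show "Mr \<iota> B n C r \<in> ?S" using ex_Mr_C_eq[OF r] by blast
qed

end

subsection \<open>The primary decomposition\<close>

text \<open>The idempotents of the Chinese remainder theorem: a Bezout identity between
  \<open>f i ^ m i\<close> and the product of the other prime powers gives \<open>e i\<close> as its
  second summand, congruent to 1 modulo \<open>f i ^ m i\<close> and divisible by the other prime
  powers. The full product, which annihilates \<open>M\<close>, then divides
  \<open>e i * e j\<close> for distinct indices as well as \<open>f i ^ m i * e i\<close>.\<close>

lemma primary_idempotents:
  fixes M :: "'a :: field mat" and f :: "nat \<Rightarrow> 'a poly"
  assumes M: "M \<in> carrier_mat n n"
    and irr: "\<And>i. i \<in> {1..s} \<Longrightarrow> monic (f i) \<and> irreducible (f i)"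
    and inj: "inj_on f {1..s}"
    and mu: "poly_mat (\<Prod>i\<in>{1..s}. f i ^ m i) M = 0\<^sub>m n n"
  obtains e w where
    "\<forall>i\<in>{1..s}. \<forall>j\<in>{1..s}. i \<noteq> j \<longrightarrow> poly_mat (e i) M * poly_mat (e j) M = 0\<^sub>m n n"
    "\<forall>i\<in>{1..s}. poly_mat (e i) M * poly_mat (e i) M = poly_mat (e i) M"
    "\<forall>i\<in>{1..s}. poly_mat (f i ^ m i) M * poly_mat (e i) M = 0\<^sub>m n n"
    "\<forall>i\<in>{1..s}. e i + w i * f i ^ m i = 1"
    "\<forall>v\<in>carrier_vec n. (\<forall>i\<in>{1..s}. poly_mat (e i) M *\<^sub>v v = 0\<^sub>v n) \<longrightarrow> v = 0\<^sub>v n"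
proof -
  let ?Q = "\<lambda>i. f i ^ m i" and ?g = "\<lambda>i. \<Prod>j\<in>{1..s} - {i}. f j ^ m j"
  let ?mu = "\<Prod>i\<in>{1..s}. ?Q i"
  have mu_eq: "?mu = ?Q i * ?g i" if "i \<in> {1..s}" for i using that by (simp add: prod.remove)
  have "\<forall>i. \<exists>w u. i \<in> {1..s} \<longrightarrow> w * ?Q i + u * ?g i = 1"
    using bezout_irreducible_power irreducible_not_dvd_prod_other[of "{1..s}" f, OF _ irr inj] irr
    by (metis finite_atLeastAtMost)
  then obtain w u where wu: "\<And>i. i \<in> {1..s} \<Longrightarrow> w i * ?Q i + u i * ?g i = 1" by metis
  define e where "e i = u i * ?g i" for i
  have c: "poly_mat p M \<in> carrier_mat n n" for p by (rule poly_mat_carrier[OF M])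
  have zero: "poly_mat p M * poly_mat q M = 0\<^sub>m n n" if "?mu dvd p * q" for p q
    using poly_mat_dvd_zero[OF M that mu] by (simp add: poly_mat_mult[OF M])
  have ew: "e i + w i * ?Q i = 1" if "i \<in> {1..s}" for i
    using wu[OF that] by (simp add: e_def add.commute)
  have Qe: "poly_mat (?Q i) M * poly_mat (e i) M = 0\<^sub>m n n" if i: "i \<in> {1..s}" for i
    unfolding e_def by (rule zero) (unfold mu_eq[OF i], intro mult_dvd_mono dvd_refl dvd_triv_right)
  show thesis
  proof (rule that[of e w]; intro ballI impI)
    fix i j assume ij: "i \<in> {1..s}" "j \<in> {1..s}" "i \<noteq> j"
    have "?Q i dvd ?g j" using ij by (intro dvd_prodI) auto
    then have "?Q i * ?g i dvd ?g j * ?g i" by (rule mult_dvd_mono) simp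
    then have "?Q i * ?g i dvd (u i * u j) * (?g j * ?g i)" by (rule dvd_mult)
    then have "?mu dvd e i * e j" unfolding mu_eq[OF ij(1)] e_def by (simp only: mult_ac)
    then show "poly_mat (e i) M * poly_mat (e j) M = 0\<^sub>m n n" by (rule zero)
  next
    fix i assume i: "i \<in> {1..s}"
    have "e i = (e i + w i * ?Q i) * e i" using ew[OF i] by simp
    then have "e i = e i * e i + w i * (?Q i * e i)" by (simp add: algebra_simps)
    then have "poly_mat (e i) M = poly_mat (e i) M * poly_mat (e i) M +
        poly_mat (w i) M * (poly_mat (?Q i) M * poly_mat (e i) M)"
      by (metis poly_mat_add[OF M] poly_mat_mult[OF M])
    also have "\<dots> = poly_mat (e i) M * poly_mat (e i) M"
      unfolding Qe[OF i] right_mult_zero_mat[OF c] using c[of "e i"] by simp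
    finally show "poly_mat (e i) M * poly_mat (e i) M = poly_mat (e i) M" by simp
  next
    fix v assume v: "v \<in> carrier_vec n"
      and 0: "\<forall>i\<in>{1..s}. poly_mat (e i) M *\<^sub>v v = 0\<^sub>v n"
    \<comment> \<open>If all \<open>e i\<close> annihilate \<open>v\<close>, each
      \<open>w i * ?Q i\<close> acts on \<open>v\<close> as the identity, and so does their product.
      That product is a multiple of \<open>?mu\<close> and acts as zero, so \<open>v\<close>
      vanishes.\<close>
    have fix1: "poly_mat (w i * ?Q i) M *\<^sub>v v = v" if i: "i \<in> {1..s}" for i
    proof -
      have "poly_mat (e i) M + poly_mat (w i * ?Q i) M = 1\<^sub>m n"
        using ew[OF i] poly_mat_add[OF M, of "e i" "w i * ?Q i"] poly_mat_1[OF M] by simp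
      then have "v = (poly_mat (e i) M + poly_mat (w i * ?Q i) M) *\<^sub>v v" using v by simp
      also have "\<dots> = poly_mat (e i) M *\<^sub>v v + poly_mat (w i * ?Q i) M *\<^sub>v v"
        by (rule add_mult_distrib_mat_vec[OF c c v])
      also have "\<dots> = poly_mat (w i * ?Q i) M *\<^sub>v v"
        unfolding 0[rule_format, OF i] using c v by (intro left_zero_vec) (rule mult_mat_vec_carrier)
      finally show ?thesis by simp
    qed
    have "poly_mat (\<Prod>i\<in>J. w i * ?Q i) M *\<^sub>v v = v" if "finite J" "J \<subseteq> {1..s}" for J
      using that
    proof (induction J)
      case empty
      then show ?case using v by (simp add: poly_mat_1[OF M])
    next
      case (insert i J)
      have "poly_mat (\<Prod>i\<in>insert i J. w i * ?Q i) M *\<^sub>v v =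
          poly_mat (w i * ?Q i) M *\<^sub>v (poly_mat (\<Prod>i\<in>J. w i * ?Q i) M *\<^sub>v v)"
        unfolding prod.insert[OF insert(1,2)] poly_mat_mult[OF M, of "w i * ?Q i" "\<Prod>i\<in>J. w i * ?Q i"]
        by (rule assoc_mult_mat_vec[OF c c v])
      then show ?case using insert fix1[of i] by simp
    qed
    from this[of "{1..s}"] have "poly_mat (\<Prod>i\<in>{1..s}. w i * ?Q i) M *\<^sub>v v = v" by simp
    moreover have "poly_mat (\<Prod>i\<in>{1..s}. w i * ?Q i) M = 0\<^sub>m n n"
      by (rule poly_mat_dvd_zero[OF M _ mu]) (simp add: prod.distrib)
    ultimately have "v = 0\<^sub>m n n *\<^sub>v v" by simp
    also have "\<dots> = 0\<^sub>v n" using v by (rule zero_mult_mat_vec)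
    finally show "v = 0\<^sub>v n" .
  qed (use Qe ew in auto)
qed

lemma smult_one_mult_mat_vec:
  fixes c :: "'a :: comm_ring_1 vec"
  assumes c: "c \<in> carrier_vec n"
  shows "a \<cdot>\<^sub>m 1\<^sub>m n *\<^sub>v c = a \<cdot>\<^sub>v c"
proof (rule eq_vecI)
  fix i assume "i < dim_vec (a \<cdot>\<^sub>v c)"
  then have i: "i < n" using c by simp
  have "(a \<cdot>\<^sub>m 1\<^sub>m n *\<^sub>v c) $ i = (\<Sum>j = 0..<n. (if i = j then a else 0) * c $ j)"
    using i c by (auto simp: scalar_prod_def intro!: sum.cong)
  also have "\<dots> = (\<Sum>j = 0..<n. if i = j then a * c $ j else 0)" by (rule sum.cong) auto
  finally show "(a \<cdot>\<^sub>m 1\<^sub>m n *\<^sub>v c) $ i = (a \<cdot>\<^sub>v c) $ i" using i c by simp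
qed (use c in simp)

context ordered_field_extension
begin

interpretation \<iota>: field_hom \<iota> by (rule hom)

text \<open>Horner's rule reduces the claim for \<open>c\<close> to the claim for the image of
  \<open>c\<close> under \<open>ext M\<close>, hence the induction with \<open>c\<close>
  arbitrary.\<close>

lemma M_code_poly_closed:
  assumes code: "is_M_code \<iota> n M C" and M: "M \<in> carrier_mat n n" and c: "c \<in> C"
  shows "ext (poly_mat p M) *\<^sub>v c \<in> C"
  using c
proof (induction p arbitrary: c)
  have C: "vsubspace n C" using code by (simp add: is_M_code_def)
  case 0
  have "ext (poly_mat 0 M) *\<^sub>v c = 0\<^sub>v n"
    using vsubspaceD(5)[OF C 0] by (auto simp: poly_mat_0[OF M] scalar_prod_def intro!: eq_vecI)
  then show ?case using vsubspaceD(2)[OF C] by simp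
next
  case (pCons a p)
  have C: "vsubspace n C" using code by (simp add: is_M_code_def)
  have c: "c \<in> carrier_vec n" by (rule vsubspaceD(5)[OF C pCons.prems])
  have Mc: "ext M *\<^sub>v c \<in> C" using code pCons.prems by (simp add: is_M_code_def)
  have P: "poly_mat p M \<in> carrier_mat n n" by (rule poly_mat_carrier[OF M])
  have "ext (poly_mat (pCons a p) M) = ext (a \<cdot>\<^sub>m 1\<^sub>m n) + ext (poly_mat p M * M)"
    unfolding poly_mat_pCons[OF M] using P M
    by (intro eq_matI) (auto simp del: index_mult_mat(1) simp: \<iota>.hom_add)
  also have "ext (poly_mat p M * M) = ext (poly_mat p M) * ext M" by (rule \<iota>.mat_hom_mult[OF P M])
  also have "ext (a \<cdot>\<^sub>m 1\<^sub>m n) = \<iota> a \<cdot>\<^sub>m 1\<^sub>m n" by (auto intro!: eq_matI)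
  finally have "ext (poly_mat (pCons a p) M) *\<^sub>v c = (\<iota> a \<cdot>\<^sub>m 1\<^sub>m n + ext (poly_mat p M) * ext M) *\<^sub>v c"
    by simp
  also have "\<dots> = \<iota> a \<cdot>\<^sub>m 1\<^sub>m n *\<^sub>v c + (ext (poly_mat p M) * ext M) *\<^sub>v c"
    by (rule add_mult_distrib_mat_vec[of _ n n]) (use P M c in auto)
  also have "(ext (poly_mat p M) * ext M) *\<^sub>v c = ext (poly_mat p M) *\<^sub>v (ext M *\<^sub>v c)"
    by (rule assoc_mult_mat_vec[of _ n n _ n]) (use P M c in auto)
  also have "\<iota> a \<cdot>\<^sub>m 1\<^sub>m n *\<^sub>v c = \<iota> a \<cdot>\<^sub>v c"
    by (rule smult_one_mult_mat_vec[OF c])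
  finally show ?case using pCons.IH[OF Mc] vsubspaceD(3,4)[OF C] pCons.prems by simp
qed

end

theorem theorem3:
  fixes \<iota> :: "'k :: field \<Rightarrow> 'l :: field" and B :: "'l list" and m n :: nat
    and M :: "'k mat" and s :: nat and f :: "nat \<Rightarrow> 'k poly"
    and mexp nexp :: "nat \<Rightarrow> nat" and P :: "nat \<Rightarrow> 'k mat"
    and C :: "'l vec set" and k :: nat
    and KL :: "nat \<Rightarrow> 'l vec set" and ki d :: "nat \<Rightarrow> nat"
    and Ci :: "nat \<Rightarrow> 'l vec set" and \<Lambda> :: "nat set" and R :: "nat \<Rightarrow> (nat \<Rightarrow> nat) set"
  assumes hom: "field_hom \<iota>"
    and basis: "ordered_basis \<iota> B" and deg: "length B = m"
    and n_pos: "n \<ge> 1" and m_ge_n: "m \<ge> n"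
    and M_carrier: "M \<in> carrier_mat n n"
    and f_irr: "\<forall>i\<in>{1..s}. monic (f i) \<and> irreducible (f i)"
    and f_distinct: "inj_on f {1..s}"
    and exps_pos: "\<forall>i\<in>{1..s}. mexp i \<ge> 1 \<and> nexp i \<ge> 1"
    and min_poly: "is_minimal_poly M (\<Prod>i\<in>{1..s}. f i ^ mexp i)"
    and char_poly: "char_poly M = (\<Prod>i\<in>{1..s}. f i ^ nexp i)"
    and P_basis: "\<forall>i\<in>{1..s}.
        P i \<in> carrier_mat (vdim n (mat_kernel (poly_mat (f i ^ mexp i) M))) n \<and>
        distinct (rows (P i)) \<and> vlin_indpt n (set (rows (P i))) \<and>
        vspan n (set (rows (P i))) = mat_kernel (poly_mat (f i ^ mexp i) M)"
    and M_code: "is_M_code \<iota> n M C" and dim_C: "vdim n C = k" and k_pos: "k \<ge> 1"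
    and KL_def: "KL = (\<lambda>i. C \<inter> mat_kernel (map_mat \<iota> (poly_mat (f i ^ mexp i) M)))"
    and ki_def: "ki = (\<lambda>i. vdim n (KL i))"
    and d_def: "d = (\<lambda>i. vdim n (mat_kernel (poly_mat (f i ^ mexp i) M)))"
    and Ci_def: "Ci = (\<lambda>i. {c \<in> carrier_vec (d i). transpose_mat (map_mat \<iota> (P i)) *\<^sub>v c \<in> KL i})"
    and Lambda_def: "\<Lambda> = {i \<in> {1..s}. KL i \<noteq> {0\<^sub>v n}}"
    and R_def: "R = (\<lambda>r. {rr :: nat \<Rightarrow> nat. (\<forall>i\<in>\<Lambda>. rr i \<le> ki i) \<and> (\<Sum>i\<in>\<Lambda>. rr i) = r})"
  shows "(\<forall>r\<in>{1..k}.
            Mr \<iota> B n C r = Min {\<Sum>i\<in>\<Lambda>. Mr \<iota> B (d i) (Ci i) (rr i) | rr. rr \<in> R r} \<and>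
            Mr \<iota> B n C r = Min {\<Sum>i\<in>\<Lambda>. Mr \<iota> B n (KL i) (rr i) | rr. rr \<in> R r})
       \<and> (\<forall>i\<in>\<Lambda>. \<forall>ri\<in>{1..ki i}.
            Mr \<iota> B (d i) (Ci i) ri = Mr \<iota> B n (KL i) ri \<and>
            int (Mr \<iota> B n (KL i) ri) \<le> int (nexp i * degree (f i)) - int (ki i) + int ri)
       \<and> (\<forall>r\<in>{1..k}.
            int (Mr \<iota> B n C r) \<le>
              Min {\<Sum>i\<in>{i\<in>\<Lambda>. rr i \<noteq> 0}. int (nexp i * degree (f i)) - int (ki i) | rr. rr \<in> R r}
              + int r)
       \<and> Mr \<iota> B n C 1 = Min ((\<lambda>i. Mr \<iota> B (d i) (Ci i) 1) ` \<Lambda>)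
       \<and> int (Min ((\<lambda>i. Mr \<iota> B (d i) (Ci i) 1) ` \<Lambda>))
            \<le> Min ((\<lambda>i. int (nexp i * degree (f i)) - int (ki i)) ` \<Lambda>) + 1
       \<and> Mr \<iota> B n C k = (\<Sum>i\<in>\<Lambda>. Mr \<iota> B (d i) (Ci i) (ki i))
       \<and> (\<Sum>i\<in>\<Lambda>. Mr \<iota> B (d i) (Ci i) (ki i)) \<le> (\<Sum>i\<in>\<Lambda>. nexp i * degree (f i))"
proof -
  interpret X: ordered_field_extension \<iota> B by (rule ordered_field_extension.intro[OF hom basis])
  interpret \<iota>: field_hom \<iota> by (rule hom)
  note M = M_carrier
  let ?Q = "\<lambda>i. poly_mat (f i ^ mexp i) M" and ?N = "\<lambda>i. nexp i * degree (f i)"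
  have irr: "monic (f i) \<and> irreducible (f i)" if "i \<in> {1..s}" for i using f_irr that by blast
  have mu: "poly_mat (\<Prod>i\<in>{1..s}. f i ^ mexp i) M = 0\<^sub>m n n"
    using min_poly M by (simp add: is_minimal_poly_def)
  obtain e w where
    orth: "\<forall>i\<in>{1..s}. \<forall>j\<in>{1..s}. i \<noteq> j \<longrightarrow> poly_mat (e i) M * poly_mat (e j) M = 0\<^sub>m n n"
    and idem: "\<forall>i\<in>{1..s}. poly_mat (e i) M * poly_mat (e i) M = poly_mat (e i) M"
    and Qe: "\<forall>i\<in>{1..s}. ?Q i * poly_mat (e i) M = 0\<^sub>m n n"
    and ew: "\<forall>i\<in>{1..s}. e i + w i * f i ^ mexp i = 1"
    and sep: "\<forall>v\<in>carrier_vec n. (\<forall>i\<in>{1..s}. poly_mat (e i) M *\<^sub>v v = 0\<^sub>v n) \<longrightarrow> v = 0\<^sub>v n"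
    by (rule primary_idempotents[OF M irr f_distinct mu])
  have C: "vsubspace n C" using M_code by (simp add: is_M_code_def)
  interpret D: decomposed_code \<iota> B n s "\<lambda>i. poly_mat (e i) M" C
    by unfold_locales
      (use orth idem sep C X.M_code_poly_closed[OF M_code M] poly_mat_carrier[OF M] in auto)
  have pc: "poly_mat p M \<in> carrier_mat n n" for p by (rule poly_mat_carrier[OF M])
  have epc: "X.ext (poly_mat p M) \<in> carrier_mat n n" for p using pc by simp
  \<comment> \<open>Since \<open>?Q i\<close> times the idempotent is zero, its fixed points lie in
    the kernel of \<open>?Q i\<close>. Conversely \<open>e i + w i * f i ^ mexp i = 1\<close> makes
    the idempotent act as the identity on that kernel.\<close>
  have comp: "D.component i = KL i" if i: "i \<in> {1..s}" for i
  proof -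
    have "X.ext (poly_mat (e i) M) *\<^sub>v c = c \<longleftrightarrow> c \<in> mat_kernel (X.ext (?Q i))" if c: "c \<in> C" for c
    proof
      have cc: "c \<in> carrier_vec n" by (rule vsubspaceD(5)[OF C c])
      assume "X.ext (poly_mat (e i) M) *\<^sub>v c = c"
      then have "X.ext (?Q i) *\<^sub>v c = (X.ext (?Q i) * X.ext (poly_mat (e i) M)) *\<^sub>v c"
        using assoc_mult_mat_vec[OF epc epc cc] by simp
      also have "X.ext (?Q i) * X.ext (poly_mat (e i) M) = X.ext (0\<^sub>m n n)"
        using \<iota>.mat_hom_mult[OF pc pc, of "f i ^ mexp i" "e i"] bspec[OF Qe i] by simp
      also have "X.ext (0\<^sub>m n n) *\<^sub>v c = 0\<^sub>v n"
        using cc by (auto simp: scalar_prod_def intro!: eq_vecI)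
      finally show "c \<in> mat_kernel (X.ext (?Q i))" by (intro mat_kernelI[OF epc cc])
    next
      have cc: "c \<in> carrier_vec n" by (rule vsubspaceD(5)[OF C c])
      assume "c \<in> mat_kernel (X.ext (?Q i))"
      then have k: "X.ext (?Q i) *\<^sub>v c = 0\<^sub>v n" by (rule mat_kernelD(2)[OF epc])
      have one: "poly_mat (e i) M + poly_mat (w i) M * ?Q i = 1\<^sub>m n"
        using bspec[OF ew i] poly_mat_add[OF M, of "e i" "w i * f i ^ mexp i"] poly_mat_1[OF M]
          poly_mat_mult[OF M, of "w i" "f i ^ mexp i"] by simp
      have "1\<^sub>m n = X.ext (poly_mat (e i) M + poly_mat (w i) M * ?Q i)"
        unfolding one by (rule \<iota>.mat_hom_one[symmetric])
      also have "\<dots> = X.ext (poly_mat (e i) M) + X.ext (poly_mat (w i) M * ?Q i)"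
        using pc[of "e i"] pc[of "w i"] pc[of "f i ^ mexp i"]
        by (intro eq_matI) (auto simp del: index_mult_mat(1) simp: \<iota>.hom_add)
      also have "X.ext (poly_mat (w i) M * ?Q i) = X.ext (poly_mat (w i) M) * X.ext (?Q i)"
        by (rule \<iota>.mat_hom_mult[OF pc pc])
      finally have "c = (X.ext (poly_mat (e i) M) + X.ext (poly_mat (w i) M) * X.ext (?Q i)) *\<^sub>v c"
        using cc by (metis one_mult_mat_vec)
      also have "\<dots> = X.ext (poly_mat (e i) M) *\<^sub>v c + (X.ext (poly_mat (w i) M) * X.ext (?Q i)) *\<^sub>v c"
        by (rule add_mult_distrib_mat_vec[OF epc mult_carrier_mat[OF epc epc] cc])
      also have "(X.ext (poly_mat (w i) M) * X.ext (?Q i)) *\<^sub>v c = X.ext (poly_mat (w i) M) *\<^sub>v 0\<^sub>v n"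
        using assoc_mult_mat_vec[OF epc epc cc] k by simp
      also have "\<dots> = 0\<^sub>v n" using epc[of "w i"] by auto
      also have "X.ext (poly_mat (e i) M) *\<^sub>v c + 0\<^sub>v n = X.ext (poly_mat (e i) M) *\<^sub>v c"
        by (rule right_zero_vec[OF mult_mat_vec_carrier[OF epc cc]])
      finally show "X.ext (poly_mat (e i) M) *\<^sub>v c = c" by simp
    qed
    then show ?thesis unfolding D.component_def KL_def by auto
  qed
  have Lam: "D.\<Lambda> = \<Lambda>" unfolding D.\<Lambda>_def Lambda_def using comp by auto
  have Ls: "\<Lambda> \<subseteq> {1..s}" and finL: "finite \<Lambda>" using D.\<Lambda>_subset D.finite_\<Lambda> Lam by auto
  have compL: "D.component i = KL i" if "i \<in> \<Lambda>" for i using comp Ls that by blast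
  have kiL: "vdim n (D.component i) = ki i" if "i \<in> \<Lambda>" for i using compL[OF that] by (simp add: ki_def)
  have k_sum: "k = (\<Sum>i\<in>\<Lambda>. ki i)" using D.vdim_C_\<Lambda> dim_C kiL by (simp add: Lam)
  have ki_pos: "ki i \<ge> 1" if "i \<in> \<Lambda>" for i using D.vdim_component_\<Lambda> that kiL by (simp add: Lam)
  have KLs: "vsubspace n (KL i)" if "i \<in> \<Lambda>" for i using D.vsubspace_component[of i] comp[of i] Ls that by auto
  have facts: "Mr \<iota> B (d i) (Ci i) r = Mr \<iota> B n (KL i) r \<and>
      (r \<le> ki i \<longrightarrow> Mr \<iota> B n (KL i) r + ki i \<le> ?N i + r)" if iL: "i \<in> \<Lambda>" for i r
  proof -
    have i: "i \<in> {1..s}" using iL Ls by auto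
    have P: "P i \<in> carrier_mat (d i) n" and dist: "distinct (rows (P i))"
      and li: "vlin_indpt n (set (rows (P i)))"
      and sp: "vspan n (set (rows (P i))) = mat_kernel (?Q i)"
      using P_basis i by (auto simp: d_def)
    have Pt: "(P i)\<^sup>T \<in> carrier_mat n (d i)" using P by simp
    have im: "(*\<^sub>v) (P i)\<^sup>T ` carrier_vec (d i) = mat_kernel (?Q i)"
      using vspan_rows[OF P] sp by simp
    \<comment> \<open>The transpose of \<open>P i\<close> maps a space of dimension
      \<open>d i\<close> onto a kernel of the same dimension, so rank-nullity makes it
      injective.\<close>
    have "vdim (d i) (carrier_vec (d i) \<inter> mat_kernel (P i)\<^sup>T) = 0"
      using vdim_rank_nullity[OF vsubspace_carrier Pt] im vdim_carrier[of "d i", where 'a = 'k]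
      by (simp add: d_def)
    then have ker0: "carrier_vec (d i) \<inter> mat_kernel (P i)\<^sup>T = {0\<^sub>v (d i)}"
      using vdim_eq_0_iff[OF vsubspace_Int[OF vsubspace_carrier vsubspace_mat_kernel[OF Pt]]] by simp
    have inj: "y = 0\<^sub>v (d i)" if "y \<in> carrier_vec (d i)" "(P i)\<^sup>T *\<^sub>v y = 0\<^sub>v n" for y
      using ker0 mat_kernelI[OF Pt that] that(1) by blast
    have tr: "(map_mat \<iota> (P i))\<^sup>T = X.ext ((P i)\<^sup>T)" by (auto intro!: eq_matI)
    \<comment> \<open>The kernel over L has no more in it than the kernel over K provides:
      coordinate vectors of an element of \<open>KL i\<close> lie in the kernel over K, which the
      rows of \<open>P i\<close> span.\<close>
    have KLim: "KL i \<subseteq> (*\<^sub>v) (X.ext ((P i)\<^sup>T)) ` carrier_vec (d i)"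
    proof
      fix c assume "c \<in> KL i"
      then have c: "c \<in> carrier_vec n" and k: "X.ext (?Q i) *\<^sub>v c = 0\<^sub>v n"
        using mat_kernelD[OF epc] by (auto simp: KL_def)
      show "c \<in> (*\<^sub>v) (X.ext ((P i)\<^sup>T)) ` carrier_vec (d i)"
      proof (rule X.in_ext_image[OF Pt c])
        fix j assume j: "j < length B"
        have "?Q i *\<^sub>v X.coord_vec j c = 0\<^sub>v n"
          using X.coord_vec_mult[OF pc c j, of "f i ^ mexp i"] k X.coord_vec_zero[OF j] by simp
        then show "X.coord_vec j c \<in> (*\<^sub>v) (P i)\<^sup>T ` carrier_vec (d i)"
          unfolding im by (intro mat_kernelI[OF pc X.coord_vec_carrier[OF c]])
      qed
    qed
    have Ci: "Ci i = {c \<in> carrier_vec (d i). X.ext ((P i)\<^sup>T) *\<^sub>v c \<in> KL i}"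
      by (simp add: Ci_def tr)
    have Mr: "Mr \<iota> B (d i) (Ci i) r = Mr \<iota> B n (KL i) r"
      unfolding Ci by (rule X.Mr_vimage_ext[OF Pt inj KLs[OF iL] KLim])
    have dimCi: "vdim (d i) (Ci i) = ki i"
      unfolding Ci using X.vdim_vimage_ext(2)[OF Pt inj KLs[OF iL] KLim] by (simp add: ki_def)
    have sCi: "vsubspace (d i) (Ci i)"
      unfolding Ci using vsubspace_vimage[OF KLs[OF iL], of "X.ext ((P i)\<^sup>T)"] Pt by simp
    have chi: "char_poly M = f i ^ nexp i * (\<Prod>j\<in>{1..s} - {i}. f j ^ nexp j)"
      unfolding char_poly using i by (simp add: prod.remove)
    have "\<not> f i dvd (\<Prod>j\<in>{1..s} - {i}. f j ^ nexp j)"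
      by (rule irreducible_not_dvd_prod_other[OF _ irr f_distinct i]) simp_all
    then have "d i \<le> ?N i"
      using irr[OF i] by (intro dim_generalized_kernel_le[OF M P dist li sp inj _ chi]) auto
    then show ?thesis using X.Mr_singleton_bound[OF sCi, of r] dimCi Mr by auto
  qed
  then have MrCi: "\<And>i r. i \<in> \<Lambda> \<Longrightarrow> Mr \<iota> B (d i) (Ci i) r = Mr \<iota> B n (KL i) r"
    and bound: "\<And>i r. i \<in> \<Lambda> \<Longrightarrow> r \<le> ki i \<Longrightarrow> Mr \<iota> B n (KL i) r + ki i \<le> ?N i + r"
    by blast+
  have upper: "Mr \<iota> B n C r \<le> (\<Sum>i\<in>\<Lambda>. Mr \<iota> B n (KL i) (rr i))" if "rr \<in> R r" for rr r
    using D.Mr_C_le_\<Lambda>[of rr] that kiL compL by (auto simp: Lam R_def)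
  have attained: "\<exists>rr\<in>R r. Mr \<iota> B n C r = (\<Sum>i\<in>\<Lambda>. Mr \<iota> B n (KL i) (rr i))" if r: "r \<le> k" for r
  proof -
    obtain rr where "\<forall>i\<in>\<Lambda>. rr i \<le> vdim n (D.component i)" "(\<Sum>i\<in>\<Lambda>. rr i) = r"
      "Mr \<iota> B n C r = (\<Sum>i\<in>\<Lambda>. Mr \<iota> B n (D.component i) (rr i))"
      using D.ex_Mr_C_eq[of r] r dim_C unfolding Lam by auto
    then show ?thesis using kiL compL by (intro bexI[of _ rr]) (auto simp: R_def)
  qed
  have A: "Mr \<iota> B n C r = Min {\<Sum>i\<in>\<Lambda>. Mr \<iota> B n (KL i) (rr i) | rr. rr \<in> R r}" if "r \<le> k" for r
  proof -
    have "{\<Sum>i\<in>\<Lambda>. Mr \<iota> B n (KL i) (rr i) | rr. rr \<in> R r} =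
      {\<Sum>i\<in>\<Lambda>. Mr \<iota> B n (D.component i) (rr i) | rr.
        (\<forall>i\<in>\<Lambda>. rr i \<le> vdim n (D.component i)) \<and> (\<Sum>i\<in>\<Lambda>. rr i) = r}"
      using kiL compL by (simp add: R_def)
    then show ?thesis using D.Mr_C_eq_Min[of r] that dim_C by (simp add: Lam)
  qed
  have A': "(\<Sum>i\<in>\<Lambda>. Mr \<iota> B (d i) (Ci i) (rr i)) = (\<Sum>i\<in>\<Lambda>. Mr \<iota> B n (KL i) (rr i))" for rr
    using MrCi by simp
  have ne: "\<Lambda> \<noteq> {}" using k_sum k_pos by auto
  have c3: "int (Mr \<iota> B n C r) \<le>
      Min {\<Sum>i\<in>{i\<in>\<Lambda>. rr i \<noteq> 0}. int (?N i) - int (ki i) | rr. rr \<in> R r} + int r" if r: "r \<le> k" for r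
  proof -
    let ?S = "{\<Sum>i\<in>{i\<in>\<Lambda>. rr i \<noteq> 0}. int (?N i) - int (ki i) | rr. rr \<in> R r}"
    \<comment> \<open>The sum depends only on the set of indices where \<open>rr\<close> is nonzero,
      a subset of the finite \<open>\<Lambda>\<close>.\<close>
    have "?S \<subseteq> (\<lambda>T. \<Sum>i\<in>T. int (?N i) - int (ki i)) ` Pow \<Lambda>" by auto
    then have "finite ?S" using finL by (meson finite_Pow_iff finite_imageI finite_subset)
    moreover have "?S \<noteq> {}" using attained[OF r] by blast
    ultimately have "Min ?S \<in> ?S" by (rule Min_in)
    then obtain rr where rr: "rr \<in> R r" "Min ?S = (\<Sum>i\<in>{i\<in>\<Lambda>. rr i \<noteq> 0}. int (?N i) - int (ki i))"
      by blast
    have "int (Mr \<iota> B n C r) \<le> (\<Sum>i\<in>\<Lambda>. int (Mr \<iota> B n (KL i) (rr i)))"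
      using upper[OF rr(1)] by (metis of_nat_mono of_nat_sum)
    \<comment> \<open>An index with \<open>rr i = 0\<close> contributes weight 0 by convention,
      whereas the Singleton expression would still contribute \<open>?N i - ki i\<close>.\<close>
    also have "\<dots> \<le> (\<Sum>i\<in>\<Lambda>. (if rr i \<noteq> 0 then int (?N i) - int (ki i) else 0) + int (rr i))"
    proof (rule sum_mono)
      fix i assume i: "i \<in> \<Lambda>"
      have "rr i \<le> ki i" using rr(1) i by (simp add: R_def)
      from bound[OF i this] show "int (Mr \<iota> B n (KL i) (rr i)) \<le>
          (if rr i \<noteq> 0 then int (?N i) - int (ki i) else 0) + int (rr i)"
        by (cases "rr i = 0") (auto simp: X.Mr_0 simp del: of_nat_mult)
    qed
    also have "\<dots> = (\<Sum>i\<in>\<Lambda>. if rr i \<noteq> 0 then int (?N i) - int (ki i) else 0) + int r"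
      using rr(1) by (simp add: sum.distrib R_def flip: of_nat_sum)
    also have "(\<Sum>i\<in>\<Lambda>. if rr i \<noteq> 0 then int (?N i) - int (ki i) else 0) = Min ?S"
      unfolding rr(2) by (rule sum.inter_filter[OF finL, symmetric])
    finally show ?thesis .
  qed
  have c4: "Mr \<iota> B n C 1 = Min ((\<lambda>i. Mr \<iota> B (d i) (Ci i) 1) ` \<Lambda>)"
  proof (rule Min_eqI[symmetric])
    show "finite ((\<lambda>i. Mr \<iota> B (d i) (Ci i) 1) ` \<Lambda>)" using finL by simp
    fix x assume "x \<in> (\<lambda>i. Mr \<iota> B (d i) (Ci i) 1) ` \<Lambda>"
    then obtain i where i: "i \<in> \<Lambda>" "x = Mr \<iota> B n (KL i) 1" using MrCi by auto
    let ?r = "\<lambda>j. if j = i then 1 else 0 :: nat"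
    have "?r \<in> R 1" using i finL ki_pos by (auto simp: R_def)
    from upper[OF this] have "Mr \<iota> B n C 1 \<le> (\<Sum>j\<in>\<Lambda>. if j = i then Mr \<iota> B n (KL j) 1 else 0)"
      by (rule order_trans) (auto intro!: sum_mono simp: X.Mr_0)
    then show "Mr \<iota> B n C 1 \<le> x" using i finL by simp
  next
    obtain rr where rr: "rr \<in> R 1" "Mr \<iota> B n C 1 = (\<Sum>i\<in>\<Lambda>. Mr \<iota> B n (KL i) (rr i))"
      using attained[of 1] k_pos by auto
    \<comment> \<open>Natural numbers with sum 1 are all zero except for a single 1, so a splitting
      of \<open>r = 1\<close> selects one component.\<close>
    then obtain i where i: "i \<in> \<Lambda>" "rr i = 1" "\<forall>j\<in>\<Lambda>. i \<noteq> j \<longrightarrow> rr j = 0"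
      using finL by (auto simp: R_def sum_eq_Suc0_iff)
    have "(\<Sum>j\<in>\<Lambda>. Mr \<iota> B n (KL j) (rr j)) = (\<Sum>j\<in>\<Lambda>. if j = i then Mr \<iota> B n (KL j) 1 else 0)"
      using i by (intro sum.cong) (auto simp: X.Mr_0)
    then have "Mr \<iota> B n C 1 = Mr \<iota> B (d i) (Ci i) 1" using rr(2) i finL MrCi by simp
    then show "Mr \<iota> B n C 1 \<in> (\<lambda>i. Mr \<iota> B (d i) (Ci i) 1) ` \<Lambda>" using i by blast
  qed
  have c5: "int (Min ((\<lambda>i. Mr \<iota> B (d i) (Ci i) 1) ` \<Lambda>)) \<le> Min ((\<lambda>i. int (?N i) - int (ki i)) ` \<Lambda>) + 1"
  proof -
    have "Min ((\<lambda>i. int (?N i) - int (ki i)) ` \<Lambda>) \<in> (\<lambda>i. int (?N i) - int (ki i)) ` \<Lambda>"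
      using finL ne by (intro Min_in) auto
    then obtain i where i: "i \<in> \<Lambda>" "Min ((\<lambda>i. int (?N i) - int (ki i)) ` \<Lambda>) = int (?N i) - int (ki i)"
      by auto
    have "Min ((\<lambda>i. Mr \<iota> B (d i) (Ci i) 1) ` \<Lambda>) \<le> Mr \<iota> B (d i) (Ci i) 1"
      using finL i by (intro Min_le) auto
    moreover have "Mr \<iota> B (d i) (Ci i) 1 + ki i \<le> ?N i + 1"
      using bound[OF i(1) ki_pos[OF i(1)]] MrCi[OF i(1)] by simp
    ultimately show ?thesis unfolding i(2) by linarith
  qed
  have c6: "Mr \<iota> B n C k = (\<Sum>i\<in>\<Lambda>. Mr \<iota> B (d i) (Ci i) (ki i))"
  proof -
    obtain rr where rr: "rr \<in> R k" "Mr \<iota> B n C k = (\<Sum>i\<in>\<Lambda>. Mr \<iota> B n (KL i) (rr i))"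
      using attained[of k] by auto
    \<comment> \<open>The \<open>ki i\<close> add up to \<open>k\<close>, so for
      \<open>r = k\<close> every bound \<open>rr i \<le> ki i\<close> is attained and only one
      splitting remains on \<open>\<Lambda>\<close>.\<close>
    have "rr i = ki i" if "i \<in> \<Lambda>" for i
      using sum_mono_inv[of rr \<Lambda> ki i] rr(1) k_sum finL that by (auto simp: R_def)
    then show ?thesis using rr(2) MrCi by simp
  qed
  have c7: "(\<Sum>i\<in>\<Lambda>. Mr \<iota> B (d i) (Ci i) (ki i)) \<le> (\<Sum>i\<in>\<Lambda>. ?N i)"
    using bound MrCi by (intro sum_mono) fastforce
  have c2: "int (Mr \<iota> B n (KL i) r) \<le> int (?N i) - int (ki i) + int r" if "i \<in> \<Lambda>" "r \<le> ki i" for i r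
    using bound[OF that] by linarith
  show ?thesis
    unfolding A'
    using A c2 MrCi c3 c4 c5 c6 c7 by simp
qed

end
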